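(* The Okamoto involution $s_0$ exchanges the apparent-singularity fibration and the quasiparabolic fibration. Precisely: on the Zariski open set of $M^1_1(\boldsymbol\kappa)$ with coordinates $(p,q)$, $q\ne0,1,t$ (and $p\neq 0$), the parabolic parameter $Q$ is given by $Q=q+\dfrac{\kappa_0}{p}$; consequently, as functions on the family of moduli spaces (with $\boldsymbol\kappa$ considered as variable), $$Q=q\circ s_0\qquad\text{and}\qquad q=Q\circ s_0,$$ where $$s_0:(\kappa_1,\kappa_2,\kappa_3,\kappa_4,q,p)\mapsto\left(\kappa_1+\kappa_0,\kappa_2+\kappa_0,\kappa_3+\kappa_0,\kappa_4+\kappa_0,\ q+\tfrac{\kappa_0}p,\ p\right).$$
   Context: Work over $\mathbb C$; $X=\mathbb P^1$ with coordinate $x$ and $(t_1,t_2,t_3,t_4)=(0,1,t,\infty)$ distinct, $D=\{0,1,t,\infty\}$. Let $\boldsymbol\kappa=(\kappa_1,\dots,\kappa_4)\in\mathbb C^4$ satisfy $\kappa_i\notin\mathbb Z$ for all $i$ and $\pm\kappa_1\pm\kappa_2\pm\kappa_3\pm\kappa_4\notin2\mathbb Z+1$ for all signs, and define $\kappa_0$ by $2\kappa_0+\kappa_1+\kappa_2+\kappa_3+\kappa_4=1$. $M^1_1(\boldsymbol\kappa)$ is the moduli space of triples $(E,\nabla,P_\bullet)$ where $E$ is a rank 2, degree 1 vector bundle on $X$, $\nabla:E\to E\otimes\Omega^1_X(\log D)$ a logarithmic connection, and $P_i\subset E_{t_i}$ lines such that $\mathrm{res}(\nabla,t_i)$ acts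 by $r_i^-$ on $P_i$ and by $r_i^+$ on $E_{t_i}/P_i$, with $(r_i^-,r_i^+)=(\frac{\kappa_i}2,-\frac{\kappa_i}2)$ for $i=1,2,3$ and $(r_4^-,r_4^+)=(\frac{\kappa_4}2-\frac12,-\frac{\kappa_4}2-\frac12)$. All such connections are irreducible and have $E\cong B=\mathcal O\oplus\mathcal O(1)$. Coordinates: let $e$ be the unit section of $\mathcal O$ and $f$ the section of $\mathcal O(1)$ vanishing at $\infty$. In the basis $\langle e,f\rangle$, $\nabla Y=dY+A\,dx\,Y$ with $A$ a $2\times2$ matrix of rational functions. The entry $A(1,2)$ is nonzero; $q\in\mathbb P^1$ is the unique zero of the induced $\mathcal O_X$-linear map $\mathcal O(1)\to\mathcal O\otimes\Omega^1_X(\log D)$ (apparent singularity). If $q\ne\infty$, then after a diagonal gauge transformation $A(1,2)=\frac{x-q}{x(x-1)(x-t)}$, and for $q\neq 0,1,t$ $$p:=A(2,2)|_{x=q}+\frac{\kappa_1}{2q}+\frac{\kappa_2}{2(q-1)}+\frac{\kappa_3}{2(q-t)},$$ which does not depend on the remaining choice of gauge. $(p,q)\in\mathbb C^2$, $q\ne0,1,t$, are coordinates on a Zariski open subset of $M^1_1(\boldsymbol\kappa)$. Parabolic parameter: there is a unique (up to scalar) nonzero map $\varphi:\mathcal O(-1)\to B=\mathcal O\oplus\mathcal O(1)$ with $\varphi(\mathcal O(-1)_{t_i})\subset P_i$ for $i=1,2,3,4$; $Q\in\mathbb P^1$ is the unique zero of the first component $\mathcal O(-1)\to\mathcal O$ of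 $\varphi$. The map $Q$ is the composite of the map sending $(E,\nabla,P_\bullet)$ to the isomorphism class of $(E,P_\bullet)$ with a natural map from the space of isomorphism classes of simple quasiparabolic bundles to $\mathbb P^1$. *)

theory Defs
  imports "HOL-Complex_Analysis.Complex_Analysis" "HOL-Computational_Algebra.Polynomial"
begin

datatype proj_line = Fin (affine: complex) | Infty

text \<open>
  The projective line is covered by the charts \<open>U\<^sub>0\<close> (coordinate \<open>x\<close>) and \<open>U\<^sub>\<infinity>\<close> (coordinate
  \<open>w = 1/x\<close>). Algebraic vector bundles are trivial on both charts, so morphisms between them are
  given by a pair of polynomial matrices (or vectors), one for each chart, in \<open>x\<close> and in \<open>w\<close>.
\<close>

definition evm :: "complex poly ^ 2 ^ 2 \<Rightarrow> complex \<Rightarrow> complex ^ 2 ^ 2" where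
  "evm M x = (\<chi> i j. poly (M $ i $ j) x)"

definition evv :: "complex poly ^ 2 \<Rightarrow> complex \<Rightarrow> complex ^ 2" where
  "evv v x = (\<chi> i. poly (v $ i) x)"

definition pderiv_mat :: "complex poly ^ 2 ^ 2 \<Rightarrow> complex poly ^ 2 ^ 2" where
  "pderiv_mat M = (\<chi> i j. pderiv (M $ i $ j))"

definition mat_at :: "(complex poly ^ 2 ^ 2) \<times> (complex poly ^ 2 ^ 2) \<Rightarrow> proj_line \<Rightarrow> complex ^ 2 ^ 2" where
  "mat_at \<psi> z = (case z of Fin a \<Rightarrow> evm (fst \<psi>) a | Infty \<Rightarrow> evm (snd \<psi>) 0)"

definition vec_at :: "(complex poly ^ 2) \<times> (complex poly ^ 2) \<Rightarrow> proj_line \<Rightarrow> complex ^ 2" where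
  "vec_at \<phi> z = (case z of Fin a \<Rightarrow> evv (fst \<phi>) a | Infty \<Rightarrow> evv (snd \<phi>) 0)"

text \<open>The index type \<open>4\<close> has the elements 1, 2, 3 and 4 (which is equal to 0).\<close>

definition sing :: "complex \<Rightarrow> 4 \<Rightarrow> proj_line" where
  "sing t i = (if i = 1 then Fin 0 else if i = 2 then Fin 1 else if i = 3 then Fin t else Infty)"

text \<open>
  A rank 2 bundle is given by its transition matrix \<open>x\<^sup>-\<^sup>k M(x)\<close>, \<open>M\<close> polynomial: coordinate vectors
  in the two frames are related by \<open>Y\<^sub>0 = g(x) Y\<^sub>\<infinity>\<close>. In this convention \<open>\<O>(n)\<close> has transition
  function \<open>x\<^sup>n\<close>, and the degree of the bundle is the exponent in \<open>det g = c x\<^sup>d\<close>. A quasiparabolic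
  bundle also has lines in the fibres over the four points, and a logarithmic connection is
  \<open>\<nabla> = d + N\<^sub>0 \<omega>\<^sub>0\<close> on \<open>U\<^sub>0\<close> and \<open>\<nabla> = d + N\<^sub>\<infinity> \<omega>\<^sub>\<infinity>\<close> on \<open>U\<^sub>\<infinity>\<close>, where \<open>N\<^sub>0\<close>, \<open>N\<^sub>\<infinity>\<close> are polynomial and
  \<open>\<omega>\<^sub>0 = dx/(x(x-1)(x-t))\<close>, \<open>\<omega>\<^sub>\<infinity> = dw/(w(1-w)(1-tw))\<close> generate the logarithmic 1-forms on the charts.
\<close>

record vbundle =
  trans_poly :: "complex poly ^ 2 ^ 2"
  trans_pole :: nat

record qpbundle = vbundle +
  pline :: "4 \<Rightarrow> (complex ^ 2) set"

record pconnection = qpbundle +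
  conn_zero :: "complex poly ^ 2 ^ 2"
  conn_infty :: "complex poly ^ 2 ^ 2"

definition transition :: "'a vbundle_scheme \<Rightarrow> complex \<Rightarrow> complex ^ 2 ^ 2" where
  "transition E x = (\<chi> i j. poly (trans_poly E $ i $ j) x / x ^ trans_pole E)"

definition transition_deriv :: "'a vbundle_scheme \<Rightarrow> complex \<Rightarrow> complex ^ 2 ^ 2" where
  "transition_deriv E x = (\<chi> i j. deriv (\<lambda>y. transition E y $ i $ j) x)"

definition is_vbundle :: "int \<Rightarrow> 'a vbundle_scheme \<Rightarrow> bool" where
  "is_vbundle d E \<longleftrightarrow> (\<exists>c. c \<noteq> 0 \<and> (\<forall>x. x \<noteq> 0 \<longrightarrow> det (transition E x) = c * x powi d))"

text \<open>
  \<open>B = \<O> \<oplus> \<O>(1)\<close>, with frame \<open>e, f\<close> on \<open>U\<^sub>0\<close> (where \<open>f\<close> vanishes at infinity) and frame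
  \<open>e, x f\<close> on \<open>U\<^sub>\<infinity>\<close>.
\<close>

definition is_B :: "'a vbundle_scheme \<Rightarrow> bool" where
  "is_B E \<longleftrightarrow> (\<forall>x. x \<noteq> 0 \<longrightarrow> transition E x = vector [vector [1, 0], vector [0, x]])"

definition is_qpbundle :: "int \<Rightarrow> 'a qpbundle_scheme \<Rightarrow> bool" where
  "is_qpbundle d E \<longleftrightarrow> is_vbundle d E \<and>
     (\<forall>i. vec.subspace (pline E i) \<and> vec.dim (pline E i) = 1)"

text \<open>Connection matrices with respect to \<open>dx\<close> on \<open>U\<^sub>0\<close> and \<open>dw\<close> on \<open>U\<^sub>\<infinity>\<close>.\<close>

definition A_zero :: "complex \<Rightarrow> 'a pconnection_scheme \<Rightarrow> complex \<Rightarrow> complex ^ 2 ^ 2" where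
  "A_zero t T x = (\<chi> i j. poly (conn_zero T $ i $ j) x / (x * (x - 1) * (x - t)))"

definition A_infty :: "complex \<Rightarrow> 'a pconnection_scheme \<Rightarrow> complex \<Rightarrow> complex ^ 2 ^ 2" where
  "A_infty t T w = (\<chi> i j. poly (conn_infty T $ i $ j) w / (w * (1 - w) * (1 - t * w)))"

text \<open>The second equation below is the gauge transformation rule, with \<open>dw = - dx / x\<^sup>2\<close>.\<close>

definition is_log_connection :: "complex \<Rightarrow> 'a pconnection_scheme \<Rightarrow> bool" where
  "is_log_connection t T \<longleftrightarrow> (\<forall>x. x \<notin> {0, 1, t} \<longrightarrow>
     A_zero t T x ** transition T x + transition_deriv T x =
     transition T x ** (\<chi> i j. - (A_infty t T (1 / x) $ i $ j) / x\<^sup>2))"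

definition res_conn :: "complex \<Rightarrow> 'a pconnection_scheme \<Rightarrow> 4 \<Rightarrow> complex ^ 2 ^ 2" where
  "res_conn t T k = (\<chi> i j. case sing t k of
       Fin a \<Rightarrow> residue (\<lambda>x. A_zero t T x $ i $ j) a
     | Infty \<Rightarrow> residue (\<lambda>w. A_infty t T w $ i $ j) 0)"

definition r_minus :: "complex ^ 4 \<Rightarrow> 4 \<Rightarrow> complex" where
  "r_minus \<kappa> i = (if i = 4 then \<kappa> $ i / 2 - 1 / 2 else \<kappa> $ i / 2)"

definition r_plus :: "complex ^ 4 \<Rightarrow> 4 \<Rightarrow> complex" where
  "r_plus \<kappa> i = (if i = 4 then - (\<kappa> $ i) / 2 - 1 / 2 else - (\<kappa> $ i) / 2)"

definition is_point :: "complex \<Rightarrow> complex ^ 4 \<Rightarrow> pconnection \<Rightarrow> bool" where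
  "is_point t \<kappa> T \<longleftrightarrow> is_qpbundle 1 T \<and> is_log_connection t T \<and>
     (\<forall>i. (\<forall>v \<in> pline T i. res_conn t T i *v v = r_minus \<kappa> i *s v) \<and>
          (\<forall>v. res_conn t T i *v v - r_plus \<kappa> i *s v \<in> pline T i))"

definition vbundle_iso ::
  "(complex poly ^ 2 ^ 2) \<times> (complex poly ^ 2 ^ 2) \<Rightarrow> 'a vbundle_scheme \<Rightarrow> 'b vbundle_scheme \<Rightarrow> bool" where
  "vbundle_iso \<psi> E E' \<longleftrightarrow>
     (\<forall>x. invertible (evm (fst \<psi>) x)) \<and> (\<forall>w. invertible (evm (snd \<psi>) w)) \<and>
     (\<forall>x. x \<noteq> 0 \<longrightarrow> evm (fst \<psi>) x ** transition E x = transition E' x ** evm (snd \<psi>) (1 / x))"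

definition qpbundle_iso ::
  "complex \<Rightarrow> (complex poly ^ 2 ^ 2) \<times> (complex poly ^ 2 ^ 2) \<Rightarrow>
     'a qpbundle_scheme \<Rightarrow> 'b qpbundle_scheme \<Rightarrow> bool" where
  "qpbundle_iso t \<psi> E E' \<longleftrightarrow> vbundle_iso \<psi> E E' \<and>
     (\<forall>i. (\<lambda>v. mat_at \<psi> (sing t i) *v v) ` pline E i = pline E' i)"

definition pconnection_iso ::
  "complex \<Rightarrow> (complex poly ^ 2 ^ 2) \<times> (complex poly ^ 2 ^ 2) \<Rightarrow>
     'a pconnection_scheme \<Rightarrow> 'b pconnection_scheme \<Rightarrow> bool" where
  "pconnection_iso t \<psi> T T' \<longleftrightarrow> qpbundle_iso t \<psi> T T' \<and>
     (\<forall>x. x \<notin> {0, 1, t} \<longrightarrow>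
        evm (pderiv_mat (fst \<psi>)) x + A_zero t T' x ** evm (fst \<psi>) x =
        evm (fst \<psi>) x ** A_zero t T x) \<and>
     (\<forall>w. w \<notin> {0, 1, 1 / t} \<longrightarrow>
        evm (pderiv_mat (snd \<psi>)) w + A_infty t T' w ** evm (snd \<psi>) w =
        evm (snd \<psi>) w ** A_infty t T w)"

definition moduli :: "complex \<Rightarrow> complex ^ 4 \<Rightarrow> pconnection set set" where
  "moduli t \<kappa> = {T. is_point t \<kappa> T} //
     {(T, T'). is_point t \<kappa> T \<and> is_point t \<kappa> T' \<and> (\<exists>\<psi>. pconnection_iso t \<psi> T T')}"

text \<open>
  Members of the isomorphism class whose bundle is \<open>B\<close> itself are the presentations of the
  connection in a basis \<open>e, f\<close>. The (1,2) entry, taken in the generators of the logarithmic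
  1-forms, is the linear map from \<open>\<O>(1)\<close> to the logarithmic 1-forms with values in \<open>\<O>\<close>.
\<close>

definition is_apparent_sing :: "pconnection set \<Rightarrow> proj_line \<Rightarrow> bool" where
  "is_apparent_sing m z \<longleftrightarrow> (\<exists>T \<in> m. is_B T \<and> conn_zero T $ 1 $ 2 \<noteq> 0 \<and>
     mat_at (conn_zero T, conn_infty T) z $ 1 $ 2 = 0)"

definition apparent_sing :: "pconnection set \<Rightarrow> proj_line" where
  "apparent_sing m = (THE z. is_apparent_sing m z)"

definition p_coord :: "complex \<Rightarrow> complex ^ 4 \<Rightarrow> pconnection set \<Rightarrow> complex" where
  "p_coord t \<kappa> m = (THE p. \<exists>T \<in> m. \<exists>q. is_B T \<and> q \<notin> {0, 1, t} \<and>
     (\<forall>x. x \<notin> {0, 1, t} \<longrightarrow> A_zero t T x $ 1 $ 2 = (x - q) / (x * (x - 1) * (x - t))) \<and>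
     p = A_zero t T q $ 2 $ 2
           + \<kappa> $ 1 / (2 * q) + \<kappa> $ 2 / (2 * (q - 1)) + \<kappa> $ 3 / (2 * (q - t)))"

definition hom_from_line_bundle ::
  "int \<Rightarrow> (complex poly ^ 2) \<times> (complex poly ^ 2) \<Rightarrow> 'a vbundle_scheme \<Rightarrow> bool" where
  "hom_from_line_bundle n \<phi> E \<longleftrightarrow>
     (\<forall>x. x \<noteq> 0 \<longrightarrow> x powi n *s evv (fst \<phi>) x = transition E x *v evv (snd \<phi>) (1 / x))"

text \<open>
  The parabolic parameter is a function on isomorphism classes of quasiparabolic bundles; on the
  moduli space of connections it is precomposed with the forgetful map.
\<close>

definition parabolic_param :: "complex \<Rightarrow> qpbundle set \<Rightarrow> proj_line" where
  "parabolic_param t c = (THE z. \<exists>E \<in> c. \<exists>\<phi>. is_B E \<and> fst \<phi> \<noteq> 0 \<and>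
     hom_from_line_bundle (-1) \<phi> E \<and> (\<forall>i. vec_at \<phi> (sing t i) \<in> pline E i) \<and>
     vec_at \<phi> z $ 1 = 0)"

definition qpbundle_class :: "complex \<Rightarrow> pconnection set \<Rightarrow> qpbundle set" where
  "qpbundle_class t m = {F. is_qpbundle 1 F \<and>
     (\<exists>T \<in> m. \<exists>\<psi>. qpbundle_iso t \<psi> (qpbundle.truncate T) F)}"

definition Q_param :: "complex \<Rightarrow> pconnection set \<Rightarrow> proj_line" where
  "Q_param t m = parabolic_param t (qpbundle_class t m)"

definition generic :: "complex ^ 4 \<Rightarrow> bool" where
  "generic \<kappa> \<longleftrightarrow> (\<forall>i. \<kappa> $ i \<notin> \<int>) \<and>
     (\<forall>\<epsilon> :: 4 \<Rightarrow> complex. (\<forall>i. \<epsilon> i \<in> {1, -1}) \<longrightarrow>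
        (\<forall>n :: int. (\<Sum>i\<in>UNIV. \<epsilon> i * \<kappa> $ i) \<noteq> 2 * of_int n + 1))"

definition kappa0 :: "complex ^ 4 \<Rightarrow> complex" where
  "kappa0 \<kappa> = (1 - (\<Sum>i\<in>UNIV. \<kappa> $ i)) / 2"

text \<open>
  The family of the open sets with coordinates \<open>p\<close>, \<open>q\<close> in the moduli spaces, \<open>\<kappa>\<close> being variable.
  That the bundle is isomorphic to \<open>B\<close> is part of having an apparent singularity.
\<close>

definition family_chart :: "complex \<Rightarrow> ((complex ^ 4) \<times> pconnection set) set" where
  "family_chart t = {(\<kappa>, m). generic \<kappa> \<and> m \<in> moduli t \<kappa> \<and>
     (\<exists>q. q \<notin> {0, 1, t} \<and> is_apparent_sing m (Fin q))}"

fun family_coords :: "complex \<Rightarrow> (complex ^ 4) \<times> pconnection set \<Rightarrow> (complex ^ 4) \<times> complex \<times> complex" where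
  "family_coords t (\<kappa>, m) = (\<kappa>, affine (apparent_sing m), p_coord t \<kappa> m)"

fun s0_coords :: "(complex ^ 4) \<times> complex \<times> complex \<Rightarrow> (complex ^ 4) \<times> complex \<times> complex" where
  "s0_coords (\<kappa>, q, p) = (\<chi> i. \<kappa> $ i + kappa0 \<kappa>, q + kappa0 \<kappa> / p, p)"

text \<open>
  The involution as a partial map of the family: it is meaningful for \<open>p \<noteq> 0\<close> when the image
  coordinates again lie in the chart.
\<close>

definition okamoto_s0 :: "complex \<Rightarrow> (complex ^ 4) \<times> pconnection set \<Rightarrow> (complex ^ 4) \<times> pconnection set" where
  "okamoto_s0 t X = (THE Y. Y \<in> family_chart t \<and> family_coords t Y = s0_coords (family_coords t X))"

end

theory Submission
  imports Defs
begin

text \<open>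
  An automorphism of \<open>\<O> \<oplus> \<O>(1)\<close> is lower triangular with constant diagonal and a linear
  polynomial as its remaining entry. Together with \<open>A(1,2)\<close>, which is proportional to
  \<open>(x - q) dx / P\<close> with \<open>P = x(x-1)(x-t)\<close>, this allows one to make \<open>A(2,2) P = - A(1,1) P\<close> a
  constant \<open>\<delta>\<close>. The eigenvalues of the residues then fix the values of the cubic \<open>A(2,1) P\<close> at
  0, 1, \<open>t\<close> and its leading coefficient, so the class is determined by \<open>q\<close> and \<open>\<delta>\<close>, that is, by
  \<open>q\<close> and \<open>p\<close>, and every pair \<open>(q, p)\<close> occurs.

  In this normal form the parabolic line at a finite \<open>t\<^sub>i\<close> is spanned by
  \<open>(t\<^sub>i - q, \<delta> + \<kappa>\<^sub>i P'(t\<^sub>i)/2)\<close> and the one at infinity by \<open>(1, (1 - \<kappa>\<^sub>4)/2)\<close>. A map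
  \<open>\<O>(-1) \<rightarrow> \<O> \<oplus> \<O>(1)\<close> is a pair of a linear polynomial \<open>u = u\<^sub>1 x + u\<^sub>0\<close> and a quadratic one.
  The conditions at 0, 1, \<open>t\<close> determine the latter by interpolation; comparing its leading
  coefficient with the condition at infinity gives \<open>u(q) p = - u\<^sub>1 \<kappa>\<^sub>0\<close>, so \<open>u\<close> vanishes at
  \<open>q + \<kappa>\<^sub>0/p\<close>. Finally \<open>s\<^sub>0\<close> preserves genericity and changes the sign of \<open>\<kappa>\<^sub>0\<close>.
\<close>

(* fps_nth and vec_nth share the symbol $; the number of parse trees grows exponentially. *)
no_notation fps_nth (infixl "$" 75)

section \<open>Isomorphisms of bundles and connections\<close>

lemma poly_eq_if_cofinite:
  fixes p r :: "'a :: {idom, ring_char_0} poly"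
  assumes "finite S" "\<And>x. x \<notin> S \<Longrightarrow> poly p x = poly r x"
  shows "p = r"
proof (rule ccontr)
  assume "p \<noteq> r"
  then have "finite {x. poly (p - r) x = 0}"
    by (intro poly_roots_finite) simp
  moreover have "UNIV = S \<union> {x. poly (p - r) x = 0}"
    using assms(2) by auto
  ultimately have "finite (UNIV :: 'a set)"
    using assms(1) by (metis finite_Un)
  then show False
    by (simp add: infinite_UNIV_char_0)
qed

lemma mat2_eq_iff:
  "(M :: 'a ^ 2 ^ 2) = N \<longleftrightarrow> M $ 1 $ 1 = N $ 1 $ 1 \<and> M $ 1 $ 2 = N $ 1 $ 2 \<and>
     M $ 2 $ 1 = N $ 2 $ 1 \<and> M $ 2 $ 2 = N $ 2 $ 2"
  by (simp add: vec_eq_iff forall_2)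

lemma vec2_eq_iff: "(v :: 'a ^ 2) = w \<longleftrightarrow> v $ 1 = w $ 1 \<and> v $ 2 = w $ 2"
  by (simp add: vec_eq_iff forall_2)

lemma mult_mat2_nth: "((M :: 'a :: semiring_1 ^ 2 ^ 2) ** N) $ i $ j = M $ i $ 1 * N $ 1 $ j + M $ i $ 2 * N $ 2 $ j"
  by (simp add: matrix_matrix_mult_def sum_2)

lemma mult_vec2_nth: "((M :: 'a :: semiring_1 ^ 2 ^ 2) *v v) $ i = M $ i $ 1 * v $ 1 + M $ i $ 2 * v $ 2"
  by (simp add: matrix_vector_mult_def sum_2)

lemma evm_nth [simp]: "evm M x $ i $ j = poly (M $ i $ j) x"
  by (simp add: evm_def)

lemma evv_nth [simp]: "evv v x $ i = poly (v $ i) x"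
  by (simp add: evv_def)

lemma pderiv_mat_nth [simp]: "pderiv_mat M $ i $ j = pderiv (M $ i $ j)"
  by (simp add: pderiv_mat_def)

lemma evm_mult: "evm (M ** N) x = evm M x ** evm N x"
  by (simp add: mat2_eq_iff mult_mat2_nth)

lemma evm_mult_vec: "evv (M *v v) x = evm M x *v evv v x"
  by (simp add: vec2_eq_iff mult_vec2_nth)

lemma evm_one [simp]: "evm (mat 1) x = mat 1"
  by (simp add: mat2_eq_iff mat_def)

lemma evm_add: "evm (M + N) x = evm M x + evm N x"
  by (simp add: mat2_eq_iff)

lemma pderiv_mat_mult: "pderiv_mat (M ** N) = pderiv_mat M ** N + M ** pderiv_mat N"
  by (simp add: mat2_eq_iff mult_mat2_nth pderiv_mult pderiv_add algebra_simps)

lemma pderiv_mat_one [simp]: "pderiv_mat (mat 1) = 0"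
  by (simp add: mat2_eq_iff mat_def)

lemma mat_at_mult: "mat_at (M ** N, M' ** N') z = mat_at (M, M') z ** mat_at (N, N') z"
  by (simp add: mat_at_def evm_mult split: proj_line.split)

lemma mat_at_one [simp]: "mat_at (mat 1, mat 1) z = mat 1"
  by (simp add: mat_at_def split: proj_line.split)

text \<open>The determinant is a polynomial without zeros, hence a nonzero constant
  \<open>c\<close>, and the adjugate divided by \<open>c\<close> is again polynomial. So inverses of
  bundle isomorphisms are algebraic.\<close>

lemma poly_matrix_inverse:
  assumes "\<And>x. invertible (evm M x)"
  obtains N where "M ** N = mat 1" "N ** M = mat 1"
proof -
  define D where "D = M $ 1 $ 1 * M $ 2 $ 2 - M $ 1 $ 2 * M $ 2 $ 1"
  have D0: "poly D x \<noteq> 0" for x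
    using assms[of x] unfolding invertible_det_nz by (simp add: D_def det_2)
  have "degree D = 0"
  proof (rule ccontr)
    assume "degree D \<noteq> 0"
    then have "coeff D 0 = 0 \<or> (\<exists>i\<in>{1..degree D}. coeff D i \<noteq> 0)"
      by (intro disjI2 bexI[of _ "degree D"]) auto
    then obtain z where "(\<Sum>i\<le>degree D. coeff D i * z ^ i) = 0"
      by (rule fundamental_theorem_of_algebra)
    then show False
      using D0[of z] by (simp add: poly_altdef)
  qed
  then obtain c where D: "D = [:c:]"
    by (rule degree_eq_zeroE)
  have "c \<noteq> 0"
    using D0[of 0] D by simp
  define N :: "complex poly ^ 2 ^ 2" where
    "N = (\<chi> i j. smult (1 / c) (if i = j then M $ (if i = 1 then 2 else 1) $ (if i = 1 then 2 else 1)
       else - (M $ i $ j)))"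
  have "smult (1 / c) D = 1"
    using D \<open>c \<noteq> 0\<close> by simp
  then have "smult (1 / c) (M $ 1 $ 1 * M $ 2 $ 2) - smult (1 / c) (M $ 1 $ 2 * M $ 2 $ 1) = 1"
    by (simp add: D_def smult_diff_right)
  then have "M ** N = mat 1" "N ** M = mat 1"
    by (simp_all add: mat2_eq_iff mult_mat2_nth mat_def N_def ac_simps)
  then show ?thesis
    using that by blast
qed

section \<open>Isomorphisms can be composed and inverted\<close>

lemma vbundle_iso_refl: "vbundle_iso (mat 1, mat 1) E E"
  by (simp add: vbundle_iso_def invertible_def)

lemma qpbundle_iso_refl: "qpbundle_iso t (mat 1, mat 1) E E"
  by (simp add: qpbundle_iso_def vbundle_iso_refl)

lemma pconnection_iso_refl: "pconnection_iso t (mat 1, mat 1) T T"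
  by (simp add: pconnection_iso_def qpbundle_iso_refl) (simp add: evm_def mat_def mat2_eq_iff)

lemma vbundle_iso_trans:
  assumes "vbundle_iso \<psi> E F" "vbundle_iso \<phi> F G"
  shows "vbundle_iso (fst \<phi> ** fst \<psi>, snd \<phi> ** snd \<psi>) E G"
proof -
  have "evm (fst \<phi>) x ** evm (fst \<psi>) x ** transition E x =
      transition G x ** (evm (snd \<phi>) (1 / x) ** evm (snd \<psi>) (1 / x))" if "x \<noteq> 0" for x
    using assms that unfolding vbundle_iso_def by (metis matrix_mul_assoc)
  then show ?thesis
    using assms by (simp add: vbundle_iso_def evm_mult invertible_mult)
qed

lemma qpbundle_iso_trans:
  assumes "qpbundle_iso t \<psi> E F" "qpbundle_iso t \<phi> F G"
  shows "qpbundle_iso t (fst \<phi> ** fst \<psi>, snd \<phi> ** snd \<psi>) E G"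
proof -
  have "(\<lambda>v. mat_at (fst \<phi> ** fst \<psi>, snd \<phi> ** snd \<psi>) z *v v) ` P =
        (\<lambda>v. mat_at \<phi> z *v v) ` ((\<lambda>v. mat_at \<psi> z *v v) ` P)" for z P
    by (simp add: image_image mat_at_mult matrix_vector_mul_assoc)
  then show ?thesis
    using assms by (auto simp: qpbundle_iso_def intro: vbundle_iso_trans)
qed

lemma matrix_mult_add_left:
  fixes A B C :: "'a :: semiring_1 ^ 2 ^ 2"
  shows "(A + B) ** C = A ** C + B ** C"
  by (simp add: mat2_eq_iff mult_mat2_nth algebra_simps)

text \<open>Composition of gauge transformations. \<open>M'\<close> and \<open>N'\<close> stand for
  derivatives; they enter only through the Leibniz expression for the derivative of
  \<open>N ** M\<close>, so this is pure matrix algebra.\<close>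

lemma gauge_trans:
  fixes M N A B C :: "complex ^ 2 ^ 2"
  assumes "M' + B ** M = M ** A" "N' + C ** N = N ** B"
  shows "(N' ** M + N ** M') + C ** (N ** M) = (N ** M) ** A"
proof -
  have "(N ** M) ** A = N ** (M' + B ** M)"
    by (simp add: assms(1) matrix_mul_assoc)
  also have "\<dots> = N ** M' + (N ** B) ** M"
    by (simp add: matrix_add_ldistrib matrix_mul_assoc)
  also have "\<dots> = N ** M' + (N' + C ** N) ** M"
    by (simp add: assms(2))
  also have "\<dots> = (N' ** M + N ** M') + C ** (N ** M)"
    by (simp add: matrix_mult_add_left matrix_mul_assoc)
  finally show ?thesis
    by simp
qed

lemma pconnection_iso_trans:
  assumes "pconnection_iso t \<psi> E F" "pconnection_iso t \<phi> F G"
  shows "pconnection_iso t (fst \<phi> ** fst \<psi>, snd \<phi> ** snd \<psi>) E G"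
  using assms qpbundle_iso_trans[of t \<psi> E F \<phi> G] unfolding pconnection_iso_def
  by (auto simp: pderiv_mat_mult evm_mult evm_add intro!: gauge_trans)

text \<open>Inversion of a gauge transformation. The last hypothesis is the derivative of
  \<open>N ** M = mat 1\<close> and takes the place of a formula for the derivative of an
  inverse.\<close>

lemma gauge_sym:
  fixes M N A B :: "complex ^ 2 ^ 2"
  assumes "M' + B ** M = M ** A" "M ** N = mat 1" "N ** M = mat 1" "N' ** M + N ** M' = 0"
  shows "N' + A ** N = N ** B"
proof -
  have "A ** N = N ** (M ** A) ** N"
    by (metis assms(3) matrix_mul_assoc matrix_mul_lid)
  also have "\<dots> = (N ** M') ** N + N ** B ** (M ** N)"
    by (simp add: assms(1)[symmetric] matrix_add_ldistrib matrix_mult_add_left matrix_mul_assoc)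
  also have "N ** M' = - (N' ** M)"
    using assms(4) by (simp add: add_eq_0_iff2 add.commute)
  also have "- (N' ** M) ** N = - (N' ** (M ** N))"
    by (simp add: mat2_eq_iff mult_mat2_nth algebra_simps)
  finally show ?thesis
    by (simp add: assms(2))
qed

lemma vbundle_iso_sym:
  assumes "vbundle_iso \<psi> E F"
  obtains \<phi> where "vbundle_iso \<phi> F E"
    "fst \<psi> ** fst \<phi> = mat 1" "fst \<phi> ** fst \<psi> = mat 1"
    "snd \<psi> ** snd \<phi> = mat 1" "snd \<phi> ** snd \<psi> = mat 1"
proof -
  obtain N where N: "fst \<psi> ** N = mat 1" "N ** fst \<psi> = mat 1"
    using assms poly_matrix_inverse unfolding vbundle_iso_def by metis
  obtain N' where N': "snd \<psi> ** N' = mat 1" "N' ** snd \<psi> = mat 1"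
    using assms poly_matrix_inverse unfolding vbundle_iso_def by metis
  have ev: "evm (fst \<psi>) x ** evm N x = mat 1" "evm N x ** evm (fst \<psi>) x = mat 1"
    "evm (snd \<psi>) x ** evm N' x = mat 1" "evm N' x ** evm (snd \<psi>) x = mat 1" for x
    by (simp_all add: evm_mult[symmetric] N N')
  have "evm N x ** transition F x = transition E x ** evm N' (1 / x)" if "x \<noteq> 0" for x
  proof -
    have "evm N x ** transition F x =
        evm N x ** (transition F x ** evm (snd \<psi>) (1 / x)) ** evm N' (1 / x)"
      using ev(3)[of "1 / x"] by (metis matrix_mul_assoc matrix_mul_rid)
    also have "transition F x ** evm (snd \<psi>) (1 / x) = evm (fst \<psi>) x ** transition E x"
      using assms that by (simp add: vbundle_iso_def)
    finally show ?thesis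
      using ev(2)[of x] by (simp add: matrix_mul_assoc)
  qed
  then have "vbundle_iso (N, N') F E"
    using ev unfolding vbundle_iso_def invertible_def fst_conv snd_conv by blast
  then show ?thesis
    using that[of "(N, N')"] N N' by simp
qed

lemma qpbundle_iso_sym:
  assumes "qpbundle_iso t \<psi> E F"
  obtains \<phi> where "qpbundle_iso t \<phi> F E"
    "fst \<psi> ** fst \<phi> = mat 1" "fst \<phi> ** fst \<psi> = mat 1"
    "snd \<psi> ** snd \<phi> = mat 1" "snd \<phi> ** snd \<psi> = mat 1"
proof -
  obtain \<phi> where \<phi>: "vbundle_iso \<phi> F E"
    "fst \<psi> ** fst \<phi> = mat 1" "fst \<phi> ** fst \<psi> = mat 1"
    "snd \<psi> ** snd \<phi> = mat 1" "snd \<phi> ** snd \<psi> = mat 1"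
    using assms vbundle_iso_sym unfolding qpbundle_iso_def by blast
  have "mat_at \<phi> z ** mat_at \<psi> z = mat 1" for z
    using mat_at_mult[of "fst \<phi>" "fst \<psi>" "snd \<phi>" "snd \<psi>" z] by (simp add: \<phi>)
  then have "(\<lambda>v. mat_at \<phi> z *v v) ` ((\<lambda>v. mat_at \<psi> z *v v) ` P) = P" for z P
    by (simp add: image_image matrix_vector_mul_assoc)
  then have "qpbundle_iso t \<phi> F E"
    using assms \<phi>(1) by (metis qpbundle_iso_def)
  then show ?thesis
    using that \<phi> by blast
qed

lemma pconnection_iso_sym:
  assumes "pconnection_iso t \<psi> E F"
  obtains \<phi> where "pconnection_iso t \<phi> F E"
proof -
  have "qpbundle_iso t \<psi> E F"
    using assms by (simp add: pconnection_iso_def)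
  then obtain \<phi> where \<phi>: "qpbundle_iso t \<phi> F E"
    "fst \<psi> ** fst \<phi> = mat 1" "fst \<phi> ** fst \<psi> = mat 1"
    "snd \<psi> ** snd \<phi> = mat 1" "snd \<phi> ** snd \<psi> = mat 1"
    using qpbundle_iso_sym by blast
  have "evm (pderiv_mat (fst \<phi>)) x ** evm (fst \<psi>) x + evm (fst \<phi>) x ** evm (pderiv_mat (fst \<psi>)) x = 0"
    "evm (pderiv_mat (snd \<phi>)) x ** evm (snd \<psi>) x + evm (snd \<phi>) x ** evm (pderiv_mat (snd \<psi>)) x = 0" for x
    using arg_cong[OF \<phi>(3), of "\<lambda>M. evm (pderiv_mat M) x"] arg_cong[OF \<phi>(5), of "\<lambda>M. evm (pderiv_mat M) x"]
    by (simp_all add: pderiv_mat_mult evm_add evm_mult, simp_all add: mat2_eq_iff)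
  moreover have "evm (fst \<psi>) x ** evm (fst \<phi>) x = mat 1" "evm (fst \<phi>) x ** evm (fst \<psi>) x = mat 1"
    "evm (snd \<psi>) x ** evm (snd \<phi>) x = mat 1" "evm (snd \<phi>) x ** evm (snd \<psi>) x = mat 1" for x
    by (simp_all add: evm_mult[symmetric] \<phi>)
  ultimately have "pconnection_iso t \<phi> F E"
    using assms \<phi>(1) unfolding pconnection_iso_def by (metis gauge_sym)
  then show ?thesis
    using that by blast
qed

definition point_rel :: "complex \<Rightarrow> complex ^ 4 \<Rightarrow> (pconnection \<times> pconnection) set" where
  "point_rel t \<kappa> = {(T, T'). is_point t \<kappa> T \<and> is_point t \<kappa> T' \<and> (\<exists>\<psi>. pconnection_iso t \<psi> T T')}"

lemma moduli_eq: "moduli t \<kappa> = {T. is_point t \<kappa> T} // point_rel t \<kappa>"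
  by (simp add: moduli_def point_rel_def)

lemma equiv_point_rel: "equiv {T. is_point t \<kappa> T} (point_rel t \<kappa>)"
proof (rule equivI)
  show "point_rel t \<kappa> \<subseteq> {T. is_point t \<kappa> T} \<times> {T. is_point t \<kappa> T}"
    by (auto simp: point_rel_def)
  show "refl_on {T. is_point t \<kappa> T} (point_rel t \<kappa>)"
    using pconnection_iso_refl by (auto simp: refl_on_def point_rel_def)
  show "sym (point_rel t \<kappa>)"
    using pconnection_iso_sym unfolding sym_def point_rel_def by blast
  show "trans (point_rel t \<kappa>)"
    using pconnection_iso_trans unfolding trans_def point_rel_def by blast
qed

section \<open>Connections on \<open>\<O> \<oplus> \<O>(1)\<close>\<close>

abbreviation mat2 :: "'a::zero \<Rightarrow> 'a \<Rightarrow> 'a \<Rightarrow> 'a \<Rightarrow> 'a ^ 2 ^ 2" where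
  "mat2 a b c d \<equiv> vector [vector [a, b], vector [c, d]]"

text \<open>Comparison of the two charts: such a pair \<open>p\<close>, \<open>r\<close> is a section of \<open>\<O>(n)\<close>.\<close>

lemma poly_inversion:
  fixes p r :: "complex poly"
  assumes "finite S" "\<And>x. x \<notin> S \<Longrightarrow> poly p x = x ^ n * poly r (1 / x)"
  shows poly_inversion_degree: "degree p \<le> n"
    and poly_inversion_poly: "\<And>x. x \<noteq> 0 \<Longrightarrow> poly p x = x ^ n * poly r (1 / x)"
proof -
  \<comment> \<open>Multiplication by x^N turns r(1/x) into the reflected polynomial of
    \<open>r\<close>. The hypothesis thus becomes an identity of polynomials, which extends to the
    nonzero points of \<open>S\<close>.\<close>
  define N where "N = degree r"
  have refl: "x ^ N * poly r (1 / x) = poly (reflect_poly r) x" if "x \<noteq> 0" for x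
    using that by (simp add: poly_reflect_poly_nz N_def inverse_eq_divide)
  have eq: "monom 1 N * p = monom 1 n * reflect_poly r"
  proof (rule poly_eq_if_cofinite[of "insert 0 S"])
    fix x assume "x \<notin> insert 0 S"
    then show "poly (monom 1 N * p) x = poly (monom 1 n * reflect_poly r) x"
      using assms(2)[of x] refl[of x] by (simp add: poly_monom algebra_simps)
  qed (use assms in simp)
  show "poly p x = x ^ n * poly r (1 / x)" if "x \<noteq> 0" for x
  proof -
    have "x ^ N * poly p x = x ^ n * (x ^ N * poly r (1 / x))"
      using arg_cong[OF eq, of "\<lambda>q. poly q x"] refl[OF that] by (simp add: poly_monom)
    then have "x ^ N * poly p x = x ^ N * (x ^ n * poly r (1 / x))"
      by (simp only: mult.left_commute)
    then show ?thesis
      using that by simp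
  qed
  show "degree p \<le> n"
  proof (cases "p = 0")
    case False
    then have "reflect_poly r \<noteq> 0"
      using eq by (metis monom_eq_0_iff mult_eq_0_iff one_neq_zero mult_zero_right)
    then have "N + degree p = n + degree (reflect_poly r)"
      using arg_cong[OF eq, of degree] False by (simp add: degree_mult_eq monom_eq_0_iff degree_monom_eq)
    then show ?thesis
      using degree_reflect_poly_le[of r] by (simp add: N_def)
  qed simp
qed

text \<open>By the degree bound only the powers x^i with i at most n occur in \<open>p\<close>, and
  x^n (1/x)^i = x^(n-i). Changing the chart therefore reverses the coefficient list, padded to
  length n + 1.\<close>

lemma poly_inversion_coeff:
  fixes p r :: "complex poly"
  assumes "finite S" "\<And>x. x \<notin> S \<Longrightarrow> poly p x = x ^ n * poly r (1 / x)"
  shows "coeff r k = (if k \<le> n then coeff p (n - k) else 0)"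
proof -
  have r: "poly r x = x ^ n * poly p (1 / x)" if "x \<noteq> 0" for x
    using poly_inversion_poly[OF assms, of "1 / x"] that by (simp add: field_simps)
  have poly: "poly p y = (\<Sum>i\<le>n. coeff p i * y ^ i)" for y
    unfolding poly_altdef using poly_inversion_degree[OF assms]
    by (intro sum.mono_neutral_left) (auto simp: coeff_eq_0)
  have "r = (\<Sum>i\<le>n. monom (coeff p i) (n - i))"
  proof (rule poly_eq_if_cofinite[of "{0}"])
    fix x :: complex assume "x \<notin> {0}"
    then have "x ^ n * (coeff p i * (1 / x) ^ i) = coeff p i * x ^ (n - i)" if "i \<le> n" for i
      using that by (simp add: power_divide power_diff)
    then have "x ^ n * poly p (1 / x) = (\<Sum>i\<le>n. coeff p i * x ^ (n - i))"
      unfolding poly sum_distrib_left by (intro sum.cong) auto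
    then have "poly r x = (\<Sum>i\<le>n. coeff p i * x ^ (n - i))"
      using r[of x] \<open>x \<notin> {0}\<close> by (metis singletonI)
    then show "poly r x = poly (\<Sum>i\<le>n. monom (coeff p i) (n - i)) x"
      by (simp add: poly_sum poly_monom)
  qed simp
  then have "coeff r k = coeff (\<Sum>i\<le>n. monom (coeff p i) (n - i)) k"
    by (rule arg_cong)
  also have "\<dots> = (\<Sum>i\<le>n. if n - i = k then coeff p i else 0)"
    by (simp add: coeff_sum)
  also have "\<dots> = (\<Sum>i\<in>{i. i \<le> n \<and> n - i = k}. coeff p i)"
    by (simp add: sum.If_cases Int_def)
  also have "{i. i \<le> n \<and> n - i = k} = (if k \<le> n then {n - k} else {})"
    by auto
  finally show ?thesis
    by simp
qed

lemma poly_eq_coeffs_1: "degree p \<le> 1 \<Longrightarrow> p = [:coeff p 0, coeff p 1:]"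
  by (rule poly_eqI) (auto simp: coeff_pCons coeff_eq_0 split: nat.split)

lemma poly_eq_coeffs_2: "degree p \<le> 2 \<Longrightarrow> p = [:coeff p 0, coeff p 1, coeff p 2:]"
  by (rule poly_eqI) (auto simp: coeff_pCons coeff_eq_0 numeral_2_eq_2 split: nat.split)

lemma poly_eq_coeffs_3: "degree p \<le> 3 \<Longrightarrow> p = [:coeff p 0, coeff p 1, coeff p 2, coeff p 3:]"
  by (rule poly_eqI) (auto simp: coeff_pCons coeff_eq_0 numeral_2_eq_2 numeral_3_eq_3 split: nat.split)

section \<open>Connection matrices on O + O(1)\<close>

lemma transition_deriv_B:
  assumes "is_B E" "x \<noteq> 0"
  shows "transition_deriv E x = mat2 0 0 0 1"
proof -
  \<comment> \<open>\<open>is_B\<close> prescribes the transition matrix only away from 0, so it is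
    compared with diag(1, y) on a neighbourhood of \<open>x\<close> that avoids 0.\<close>
  have ev: "\<forall>\<^sub>F y in nhds x. transition E y = mat2 1 0 0 y"
    using eventually_nhds_in_open[of "- {0}" x] assms
    by (auto elim: eventually_mono simp: is_B_def open_Compl)
  have "deriv (\<lambda>y. transition E y $ i $ j) x = deriv (\<lambda>y. mat2 1 0 0 y $ i $ j) x" for i j
    by (intro deriv_cong_ev refl eventually_mono[OF ev]) simp
  then show ?thesis
    by (simp add: transition_deriv_def mat2_eq_iff)
qed

lemma is_vbundle_B: "is_B E \<Longrightarrow> is_vbundle 1 E"
  unfolding is_vbundle_def is_B_def by (intro exI[of _ 1]) (simp add: det_2)

text \<open>The logarithmic 1-forms are isomorphic to O(2), so the entries (1,1), (1,2), (2,1) are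
  sections of O(2), O(1), O(3); these are the exponents. The (2,2) entry also meets the derivative
  of the transition function x. Multiplied by x, this contributes the cubic x(x-1)(x-t) and raises
  the exponent from 2 to 3.\<close>

lemma is_log_connection_B_iff:
  assumes "is_B T"
  shows "is_log_connection t T \<longleftrightarrow> (\<forall>x. x \<notin> {0, 1, t} \<longrightarrow>
     poly (conn_zero T $ 1 $ 1) x = x ^ 2 * poly (- (conn_infty T $ 1 $ 1)) (1 / x) \<and>
     poly (conn_zero T $ 1 $ 2) x = x ^ 1 * poly (- (conn_infty T $ 1 $ 2)) (1 / x) \<and>
     poly (conn_zero T $ 2 $ 1) x = x ^ 3 * poly (- (conn_infty T $ 2 $ 1)) (1 / x) \<and>
     poly ([:0, 1:] * conn_zero T $ 2 $ 2 + [:0, t, - (1 + t), 1:]) x =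
       x ^ 3 * poly (- (conn_infty T $ 2 $ 2)) (1 / x))"
proof -
  have "A_zero t T x ** transition T x + transition_deriv T x =
     transition T x ** (\<chi> i j. - (A_infty t T (1 / x) $ i $ j) / x\<^sup>2) \<longleftrightarrow>
     poly (conn_zero T $ 1 $ 1) x = x ^ 2 * poly (- (conn_infty T $ 1 $ 1)) (1 / x) \<and>
     poly (conn_zero T $ 1 $ 2) x = x ^ 1 * poly (- (conn_infty T $ 1 $ 2)) (1 / x) \<and>
     poly (conn_zero T $ 2 $ 1) x = x ^ 3 * poly (- (conn_infty T $ 2 $ 1)) (1 / x) \<and>
     poly ([:0, 1:] * conn_zero T $ 2 $ 2 + [:0, t, - (1 + t), 1:]) x =
       x ^ 3 * poly (- (conn_infty T $ 2 $ 2)) (1 / x)" if x: "x \<notin> {0, 1, t}" for x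
  proof -
    have nz: "x \<noteq> 0" "x - 1 \<noteq> 0" "x - t \<noteq> 0"
      using x by auto
    define P where "P = x * (x - 1) * (x - t)"
    have "P \<noteq> 0"
      using nz by (simp add: P_def)
    have inf: "A_infty t T (1 / x) $ i $ j = x ^ 4 * poly (conn_infty T $ i $ j) (1 / x) / P" for i j
    proof -
      have "1 / x * (1 - 1 / x) * (1 - t * (1 / x)) = P / x ^ 4"
        using nz by (simp add: P_def divide_simps power4_eq_xxxx)
      then show ?thesis
        using nz \<open>P \<noteq> 0\<close> by (simp add: A_infty_def)
    qed
    have zero: "A_zero t T x $ i $ j = poly (conn_zero T $ i $ j) x / P" for i j
      by (simp add: A_zero_def P_def)
    have tr: "transition T x = mat2 1 0 0 x"
      using assms nz by (simp add: is_B_def)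
    have P': "poly ([:0, 1:] * conn_zero T $ 2 $ 2 + [:0, t, - (1 + t), 1:]) x =
        x * poly (conn_zero T $ 2 $ 2) x + P"
      by (simp add: P_def algebra_simps)
    have cancel: "x * u = - (x * w) \<longleftrightarrow> u = - w" "P * P + P * u = - (P * w) \<longleftrightarrow> P + u = - w" for u w
      using nz \<open>P \<noteq> 0\<close> mult_left_cancel[of x u "- w"] mult_left_cancel[of P "P + u" "- w"]
      by (simp_all add: distrib_left)
    show ?thesis
      using \<open>P \<noteq> 0\<close> nz unfolding mat2_eq_iff P'
      by (simp add: mult_mat2_nth tr transition_deriv_B[OF assms] inf zero)
        (simp add: field_simps power2_eq_square power3_eq_cube power4_eq_xxxx cancel)
  qed
  then show ?thesis
    by (simp add: is_log_connection_def)
qed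

text \<open>The matrix at infinity arises by reversing coefficients and changing signs. The extra
  terms 1, 1 + t and t in its (2,2) entry come from the cubic x(x-1)(x-t).\<close>

lemma is_log_connection_B_coeffs:
  assumes "is_B T"
  shows "is_log_connection t T \<longleftrightarrow> (\<exists>a0 a1 a2 b0 b1 c0 c1 c2 c3 d0 d1 d2.
    conn_zero T = mat2 [:a0, a1, a2:] [:b0, b1:] [:c0, c1, c2, c3:] [:d0, d1, d2:] \<and>
    conn_infty T = mat2 [:- a2, - a1, - a0:] [:- b1, - b0:] [:- c3, - c2, - c1, - c0:]
      [:- (d2 + 1), 1 + t - d1, - d0 - t:])" (is "_ \<longleftrightarrow> ?R")
proof
  assume "is_log_connection t T"
  then have eq: "poly (conn_zero T $ 1 $ 1) x = x ^ 2 * poly (- (conn_infty T $ 1 $ 1)) (1 / x)"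
    "poly (conn_zero T $ 1 $ 2) x = x ^ 1 * poly (- (conn_infty T $ 1 $ 2)) (1 / x)"
    "poly (conn_zero T $ 2 $ 1) x = x ^ 3 * poly (- (conn_infty T $ 2 $ 1)) (1 / x)"
    "poly ([:0, 1:] * conn_zero T $ 2 $ 2 + [:0, t, - (1 + t), 1:]) x =
       x ^ 3 * poly (- (conn_infty T $ 2 $ 2)) (1 / x)" if "x \<notin> {0, 1, t}" for x
    using that is_log_connection_B_iff[OF assms] by blast+
  have fin: "finite {0, 1, t}"
    by simp
  note deg = poly_inversion_degree[OF fin eq(1)] poly_inversion_degree[OF fin eq(2)]
    poly_inversion_degree[OF fin eq(3)] poly_inversion_degree[OF fin eq(4)]
  note coe = poly_inversion_coeff[OF fin eq(1)] poly_inversion_coeff[OF fin eq(2)]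
    poly_inversion_coeff[OF fin eq(3)] poly_inversion_coeff[OF fin eq(4)]
  have "degree ([:0, 1:] * conn_zero T $ 2 $ 2) \<le> 3"
    using degree_diff_le[OF deg(4), of "[:0, t, - (1 + t), 1:]"] by simp
  then have d: "degree (conn_zero T $ 2 $ 2) \<le> 2"
    by (cases "conn_zero T $ 2 $ 2 = 0") (simp_all add: degree_mult_eq)
  define a b c d where "a = conn_zero T $ 1 $ 1" "b = conn_zero T $ 1 $ 2"
    "c = conn_zero T $ 2 $ 1" "d = conn_zero T $ 2 $ 2"
  note defs = this
  have "conn_zero T = mat2 [:coeff a 0, coeff a 1, coeff a 2:] [:coeff b 0, coeff b 1:]
    [:coeff c 0, coeff c 1, coeff c 2, coeff c 3:] [:coeff d 0, coeff d 1, coeff d 2:]"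
    using poly_eq_coeffs_2[OF deg(1)] poly_eq_coeffs_1[OF deg(2)] poly_eq_coeffs_3[OF deg(3)]
      poly_eq_coeffs_2[OF d] by (simp add: mat2_eq_iff defs)
  moreover have "conn_infty T = mat2 [:- coeff a 2, - coeff a 1, - coeff a 0:] [:- coeff b 1, - coeff b 0:]
    [:- coeff c 3, - coeff c 2, - coeff c 1, - coeff c 0:]
    [:- (coeff d 2 + 1), 1 + t - coeff d 1, - coeff d 0 - t:]"
  proof -
    have "- (conn_infty T $ 1 $ 1) = [:coeff a 2, coeff a 1, coeff a 0:]"
      by (rule poly_eqI, subst coe(1)) (auto simp: coeff_pCons defs numeral_2_eq_2 split: nat.split)
    moreover have "- (conn_infty T $ 1 $ 2) = [:coeff b 1, coeff b 0:]"
      by (rule poly_eqI, subst coe(2)) (auto simp: coeff_pCons defs numeral_2_eq_2 split: nat.split)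
    moreover have "- (conn_infty T $ 2 $ 1) = [:coeff c 3, coeff c 2, coeff c 1, coeff c 0:]"
      by (rule poly_eqI, subst coe(3)) (auto simp: coeff_pCons defs numeral_2_eq_2 numeral_3_eq_3 split: nat.split)
    moreover have "- (conn_infty T $ 2 $ 2) = [:coeff d 2 + 1, coeff d 1 - (1 + t), coeff d 0 + t, 0:]"
      by (rule poly_eqI, subst coe(4)) (auto simp: coeff_pCons defs numeral_2_eq_2 numeral_3_eq_3 split: nat.split)
    ultimately show ?thesis
      by (simp add: mat2_eq_iff minus_equation_iff[of "conn_infty T $ _ $ _"])
  qed
  ultimately show ?R
    by blast
next
  assume ?R
  then obtain a0 a1 a2 b0 b1 c0 c1 c2 c3 d0 d1 d2 where
    "conn_zero T = mat2 [:a0, a1, a2:] [:b0, b1:] [:c0, c1, c2, c3:] [:d0, d1, d2:]"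
    "conn_infty T = mat2 [:- a2, - a1, - a0:] [:- b1, - b0:] [:- c3, - c2, - c1, - c0:]
      [:- (d2 + 1), 1 + t - d1, - d0 - t:]"
    by blast
  then show "is_log_connection t T"
    unfolding is_log_connection_B_iff[OF assms]
    by (simp add: field_simps power2_eq_square power3_eq_cube)
qed

section \<open>Residues and the parabolic lines they determine\<close>

lemma residue_rational:
  assumes "open S" "z \<in> S" "g holomorphic_on S" "\<And>w. w \<in> S \<Longrightarrow> g w \<noteq> 0"
    and "\<And>w. h w = g w * (w - z)"
  shows "residue (\<lambda>w. poly p w / h w) z = poly p z / g z"
proof -
  have "(\<lambda>w. poly p w / h w) = (\<lambda>w. (poly p w / g w) / (w - z))"
    by (simp add: assms(5))
  moreover have "residue (\<lambda>w. (poly p w / g w) / (w - z)) z = poly p z / g z"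
    using assms(1-4) by (intro residue_simple) (auto intro!: holomorphic_intros)
  ultimately show ?thesis
    by simp
qed

text \<open>At a simple pole the residue is the numerator over the derivative of the denominator.
  For x(x-1)(x-t) this derivative is t, 1 - t, t(t - 1) at 0, 1, t; for w(1-w)(1-tw) it is 1 at w =
  0.\<close>

lemma res_conn_nth:
  assumes "t \<noteq> 0" "t \<noteq> 1"
  shows "res_conn t T 1 $ i $ j = poly (conn_zero T $ i $ j) 0 / t"
    and "res_conn t T 2 $ i $ j = poly (conn_zero T $ i $ j) 1 / (1 - t)"
    and "res_conn t T 3 $ i $ j = poly (conn_zero T $ i $ j) t / (t * (t - 1))"
    and "res_conn t T 4 $ i $ j = poly (conn_infty T $ i $ j) 0"
proof -
  have op: "open (- {a, b :: complex})" for a b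
    by (intro open_Compl finite_imp_closed) simp
  have "residue (\<lambda>x. poly p x / (x * (x - 1) * (x - t))) 0 = poly p 0 / ((0 - 1) * (0 - t))" for p
    by (rule residue_rational[where S = "- {1, t}"]) (use assms op in \<open>auto intro!: holomorphic_intros\<close>)
  then show "res_conn t T 1 $ i $ j = poly (conn_zero T $ i $ j) 0 / t"
    by (simp add: res_conn_def sing_def A_zero_def)
  have "residue (\<lambda>x. poly p x / (x * (x - 1) * (x - t))) 1 = poly p 1 / (1 * (1 - t))" for p
    by (rule residue_rational[where S = "- {0, t}"]) (use assms op in \<open>auto intro!: holomorphic_intros\<close>)
  then show "res_conn t T 2 $ i $ j = poly (conn_zero T $ i $ j) 1 / (1 - t)"
    by (simp add: res_conn_def sing_def A_zero_def)
  have "residue (\<lambda>x. poly p x / (x * (x - 1) * (x - t))) t = poly p t / (t * (t - 1))" for p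
    by (rule residue_rational[where S = "- {0, 1}"]) (use assms op in \<open>auto intro!: holomorphic_intros\<close>)
  then show "res_conn t T 3 $ i $ j = poly (conn_zero T $ i $ j) t / (t * (t - 1))"
    by (simp add: res_conn_def sing_def A_zero_def)
  have "residue (\<lambda>w. poly p w / (w * (1 - w) * (1 - t * w))) 0 = poly p 0 / ((1 - 0) * (1 - t * 0))" for p
    by (rule residue_rational[where S = "- {1, 1 / t}" and g = "\<lambda>w. (1 - w) * (1 - t * w)"])
      (use assms op in \<open>auto intro!: holomorphic_intros simp: eq_divide_eq mult.commute\<close>)
  then show "res_conn t T 4 $ i $ j = poly (conn_infty T $ i $ j) 0"
    by (simp add: res_conn_def sing_def A_infty_def)
qed

definition eigenspace :: "complex ^ 2 ^ 2 \<Rightarrow> complex \<Rightarrow> (complex ^ 2) set" where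
  "eigenspace R r = {v. R *v v = r *s v}"

text \<open>\<open>R - r'\<close> maps everything into the line \<open>P\<close>, so it has rank at
  most one, and it acts on \<open>P\<close> by \<open>r - r'\<close>, which is therefore its trace.
  Trace and determinant of \<open>R\<close> follow. An \<open>r\<close>-eigenvector lies in
  \<open>P\<close> because \<open>R - r'\<close> multiplies it by the nonzero number
  \<open>r - r'\<close>.\<close>

lemma parabolic_line_imp:
  assumes P: "vec.subspace P" "vec.dim P = 1"
    and R: "\<And>v. v \<in> P \<Longrightarrow> R *v v = r *s v" "\<And>v. R *v v - r' *s v \<in> P" and "r \<noteq> r'"
  shows "P = eigenspace R r" "R $ 1 $ 1 + R $ 2 $ 2 = r + r'"
    "R $ 1 $ 1 * R $ 2 $ 2 - R $ 1 $ 2 * R $ 2 $ 1 = r * r'"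
proof -
  show "P = eigenspace R r"
  proof (intro equalityI subsetI)
    fix v assume "v \<in> eigenspace R r"
    then have "(r - r') *s v \<in> P"
      using R(2)[of v] by (simp add: eigenspace_def vec.scale_left_diff_distrib)
    then have "(1 / (r - r')) *s ((r - r') *s v) \<in> P"
      by (rule vec.subspace_scale[OF P(1)])
    moreover have "(1 / (r - r')) *s ((r - r') *s v) = v"
      unfolding vec.scale_scale using \<open>r \<noteq> r'\<close> by simp
    ultimately show "v \<in> P"
      by (simp only:)
  qed (use R(1) in \<open>simp add: eigenspace_def\<close>)
  obtain B where B: "B \<subseteq> P" "vec.independent B" "P \<subseteq> vec.span B" "card B = 1"
    using vec.basis_exists[of P] P(2) by metis
  then obtain v where "B = {v}"
    by (auto simp: card_1_singleton_iff)
  then have v: "v \<in> P" "v \<noteq> 0" and line: "\<And>w. w \<in> P \<Longrightarrow> \<exists>k. w = k *s v"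
    using B by (auto simp: vec.span_singleton)
  \<comment> \<open>The images of the two basis vectors write \<open>R - r'\<close> as the product
    of the column \<open>v\<close> and the row (s, k).\<close>
  obtain s where s: "R *v vector [1, 0] - r' *s vector [1, 0] = s *s v"
    using R(2) line by blast
  obtain k where k: "R *v vector [0, 1] - r' *s vector [0, 1] = k *s v"
    using R(2) line by blast
  have e: "R $ 1 $ 1 = r' + s * v $ 1" "R $ 2 $ 1 = s * v $ 2" "R $ 1 $ 2 = k * v $ 1" "R $ 2 $ 2 = r' + k * v $ 2"
    using s k by (simp_all add: vec2_eq_iff mult_vec2_nth algebra_simps)
  have "(s * v $ 1 + k * v $ 2 - (r - r')) * v $ 1 = 0" "(s * v $ 1 + k * v $ 2 - (r - r')) * v $ 2 = 0"
  proof -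
    have "(r' + s * v $ 1) * v $ 1 + (k * v $ 1) * v $ 2 = r * v $ 1"
      "(s * v $ 2) * v $ 1 + (r' + k * v $ 2) * v $ 2 = r * v $ 2"
      using R(1)[OF v(1)] unfolding vec2_eq_iff mult_vec2_nth e vector_smult_component by blast+
    then show "(s * v $ 1 + k * v $ 2 - (r - r')) * v $ 1 = 0" "(s * v $ 1 + k * v $ 2 - (r - r')) * v $ 2 = 0"
      by algebra+
  qed
  moreover have "v $ 1 \<noteq> 0 \<or> v $ 2 \<noteq> 0"
    using v(2) by (simp add: vec2_eq_iff)
  ultimately have sum: "s * v $ 1 + k * v $ 2 = r - r'"
    by (metis mult_eq_0_iff right_minus_eq)
  show "R $ 1 $ 1 + R $ 2 $ 2 = r + r'"
    unfolding e using sum by algebra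
  have "R $ 1 $ 1 * R $ 2 $ 2 - R $ 1 $ 2 * R $ 2 $ 1 = r' * (r' + (s * v $ 1 + k * v $ 2))"
    unfolding e by algebra
  then show "R $ 1 $ 1 * R $ 2 $ 2 - R $ 1 $ 2 * R $ 2 $ 1 = r * r'"
    by (simp add: sum)
qed

text \<open>A converse to \<open>parabolic_line_imp\<close>. As the (1,2) entry is nonzero, the
  first row of the eigenvector equation cuts out a line and the second row follows from it. The last
  claim is the Cayley-Hamilton identity (R - r)(R - r') = 0.\<close>

lemma parabolic_line_eigenspace:
  assumes "R $ 1 $ 2 \<noteq> 0" "R $ 1 $ 1 + R $ 2 $ 2 = r + r'"
    "R $ 1 $ 1 * R $ 2 $ 2 - R $ 1 $ 2 * R $ 2 $ 1 = r * r'"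
  shows "eigenspace R r = {v. R $ 1 $ 2 * v $ 2 = (r - R $ 1 $ 1) * v $ 1}"
    "vec.subspace (eigenspace R r)" "vec.dim (eigenspace R r) = 1"
    "R *v v - r' *s v \<in> eigenspace R r"
proof -
  have R22: "R $ 2 $ 2 = r + r' - R $ 1 $ 1"
    using assms(2) by (simp add: algebra_simps)
  have R21: "R $ 1 $ 2 * R $ 2 $ 1 = R $ 1 $ 1 * (r + r' - R $ 1 $ 1) - r * r'"
    using assms(3) R22 by (simp add: algebra_simps)
  show eq: "eigenspace R r = {v. R $ 1 $ 2 * v $ 2 = (r - R $ 1 $ 1) * v $ 1}"
  proof -
    have "R $ 2 $ 1 * x + R $ 2 $ 2 * y = r * y" if "R $ 1 $ 2 * y = (r - R $ 1 $ 1) * x" for x y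
    proof -
      \<comment> \<open>The (2,1) entry is controlled only through its product with the (1,2) entry,
        so the equation is multiplied by the latter, which is cancelled at the end.\<close>
      have "R $ 1 $ 2 * (R $ 2 $ 1 * x + R $ 2 $ 2 * y) = (R $ 1 $ 2 * R $ 2 $ 1) * x + R $ 2 $ 2 * (R $ 1 $ 2 * y)"
        by (simp add: algebra_simps)
      also have "\<dots> = r * ((r - R $ 1 $ 1) * x)"
        unfolding R21 that R22 by (simp add: algebra_simps)
      also have "\<dots> = R $ 1 $ 2 * (r * y)"
        using that by algebra
      finally show ?thesis
        using assms(1) by (metis mult_left_cancel)
    qed
    then show ?thesis
      unfolding eigenspace_def vec2_eq_iff mult_vec2_nth
      by (auto simp: algebra_simps)
  qed
  define w :: "complex ^ 2" where "w = vector [R $ 1 $ 2, r - R $ 1 $ 1]"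
  have "w \<noteq> 0"
    using assms(1) by (simp add: w_def vec2_eq_iff)
  have span: "eigenspace R r = vec.span {w}"
  proof -
    have "\<exists>k. v = k *s w" if "R $ 1 $ 2 * v $ 2 = (r - R $ 1 $ 1) * v $ 1" for v
      using that assms(1) by (intro exI[of _ "v $ 1 / R $ 1 $ 2"]) (simp add: w_def vec2_eq_iff field_simps)
    then show ?thesis
      unfolding eq vec.span_singleton by (auto simp: w_def)
  qed
  show "vec.subspace (eigenspace R r)"
    unfolding span by (rule vec.subspace_span)
  show "vec.dim (eigenspace R r) = 1"
    unfolding span using \<open>w \<noteq> 0\<close> by (simp add: vec.dim_eq_card_independent)
  show "R *v v - r' *s v \<in> eigenspace R r"
  proof -
    have "R $ 1 $ 2 * (R $ 2 $ 1 * v $ 1 + R $ 2 $ 2 * v $ 2 - r' * v $ 2) =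
        (R $ 1 $ 2 * R $ 2 $ 1) * v $ 1 + R $ 1 $ 2 * (R $ 2 $ 2 - r') * v $ 2"
      by (simp add: algebra_simps)
    also have "\<dots> = (r - R $ 1 $ 1) * (R $ 1 $ 1 * v $ 1 + R $ 1 $ 2 * v $ 2 - r' * v $ 1)"
      unfolding R21 R22 by (simp add: algebra_simps)
    finally show ?thesis
      by (simp add: eq mult_vec2_nth)
  qed
qed

lemma image_eigenspace:
  assumes "M ** N = mat 1" "N ** M = mat 1" "S ** M = M ** R"
  shows "(\<lambda>v. M *v v) ` eigenspace R r = eigenspace S r"
proof (intro equalityI subsetI)
  fix w assume "w \<in> (\<lambda>v. M *v v) ` eigenspace R r"
  then obtain v where "w = M *v v" "R *v v = r *s v"
    by (auto simp: eigenspace_def)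
  then show "w \<in> eigenspace S r"
    using assms(3) by (simp add: eigenspace_def matrix_vector_mul_assoc vec.scale flip: matrix_vector_mul_assoc[of M R])
next
  fix w assume "w \<in> eigenspace S r"
  then have w: "S *v w = r *s w"
    by (simp add: eigenspace_def)
  have "R ** N = N ** S"
    by (metis assms matrix_mul_assoc matrix_mul_lid matrix_mul_rid)
  then have "R *v (N *v w) = r *s (N *v w)"
    using w by (metis matrix_vector_mul_assoc vec.scale)
  moreover have "w = M *v (N *v w)"
    by (simp add: matrix_vector_mul_assoc assms(1))
  ultimately show "w \<in> (\<lambda>v. M *v v) ` eigenspace R r"
    by (auto simp: eigenspace_def)
qed

text \<open>The entries (1,1), (1,2), (2,1), (2,2) are sections of O, O(-1), O(1), O. Hence the
  diagonal is constant, the (1,2) entry is zero and the (2,1) entry is linear, with its two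
  coefficients exchanged in the chart at infinity.\<close>

lemma vbundle_iso_B:
  assumes "is_B E" "is_B F" "vbundle_iso \<psi> E F"
  obtains \<alpha> \<beta> u v where "\<alpha> \<noteq> 0" "\<beta> \<noteq> 0"
    "fst \<psi> = mat2 [:\<alpha>:] 0 [:u, v:] [:\<beta>:]" "snd \<psi> = mat2 [:\<alpha>:] 0 [:v, u:] [:\<beta>:]"
proof -
  let ?M = "fst \<psi>" and ?N = "snd \<psi>"
  have eq: "poly (?M $ 1 $ 1) x = x ^ 0 * poly (?N $ 1 $ 1) (1 / x)"
    "poly ([:0, 1:] * ?M $ 1 $ 2) x = x ^ 0 * poly (?N $ 1 $ 2) (1 / x)"
    "poly (?M $ 2 $ 1) x = x ^ 1 * poly (?N $ 2 $ 1) (1 / x)"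
    "poly (?M $ 2 $ 2) x = x ^ 0 * poly (?N $ 2 $ 2) (1 / x)" if "x \<notin> {0}" for x
  proof -
    have "x \<noteq> 0"
      using that by simp
    then have "evm ?M x ** mat2 1 0 0 x = mat2 1 0 0 x ** evm ?N (1 / x)"
      using assms by (simp add: vbundle_iso_def is_B_def)
    then show "poly (?M $ 1 $ 1) x = x ^ 0 * poly (?N $ 1 $ 1) (1 / x)"
      "poly ([:0, 1:] * ?M $ 1 $ 2) x = x ^ 0 * poly (?N $ 1 $ 2) (1 / x)"
      "poly (?M $ 2 $ 1) x = x ^ 1 * poly (?N $ 2 $ 1) (1 / x)"
      "poly (?M $ 2 $ 2) x = x ^ 0 * poly (?N $ 2 $ 2) (1 / x)"
      using \<open>x \<noteq> 0\<close> by (simp_all add: mat2_eq_iff mult_mat2_nth mult.commute)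
  qed
  have fin: "finite {0 :: complex}"
    by simp
  note deg = poly_inversion_degree[OF fin eq(1)] poly_inversion_degree[OF fin eq(2)]
    poly_inversion_degree[OF fin eq(3)] poly_inversion_degree[OF fin eq(4)]
  note coe = poly_inversion_coeff[OF fin eq(1)] poly_inversion_coeff[OF fin eq(2)]
    poly_inversion_coeff[OF fin eq(3)] poly_inversion_coeff[OF fin eq(4)]
  \<comment> \<open>x times this entry has degree 0, which is impossible for a nonzero
    polynomial.\<close>
  have M12: "?M $ 1 $ 2 = 0"
    using deg(2) by (cases "?M $ 1 $ 2 = 0") (simp_all add: degree_mult_eq)
  obtain \<alpha> where \<alpha>: "?M $ 1 $ 1 = [:\<alpha>:]"
    using deg(1) by (auto elim: degree_eq_zeroE)
  obtain \<beta> where \<beta>: "?M $ 2 $ 2 = [:\<beta>:]"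
    using deg(4) by (auto elim: degree_eq_zeroE)
  define u v where "u = coeff (?M $ 2 $ 1) 0" "v = coeff (?M $ 2 $ 1) 1"
  then have M21: "?M $ 2 $ 1 = [:u, v:]"
    using poly_eq_coeffs_1[OF deg(3)] by simp
  have M: "?M = mat2 [:\<alpha>:] 0 [:u, v:] [:\<beta>:]"
    by (simp add: mat2_eq_iff M12 \<alpha> \<beta> M21)
  have "?N $ 1 $ 1 = [:\<alpha>:]"
    by (rule poly_eqI, subst coe(1)) (auto simp: \<alpha> coeff_pCons split: nat.split)
  moreover have "?N $ 1 $ 2 = 0"
    by (rule poly_eqI, subst coe(2)) (auto simp: M12)
  moreover have "?N $ 2 $ 1 = [:v, u:]"
    by (rule poly_eqI, subst coe(3)) (auto simp: M21 coeff_pCons split: nat.split)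
  moreover have "?N $ 2 $ 2 = [:\<beta>:]"
    by (rule poly_eqI, subst coe(4)) (auto simp: \<beta> coeff_pCons split: nat.split)
  ultimately have N: "?N = mat2 [:\<alpha>:] 0 [:v, u:] [:\<beta>:]"
    by (simp add: mat2_eq_iff)
  have "invertible (evm ?M 0)"
    using assms(3) by (simp add: vbundle_iso_def)
  then have "\<alpha> \<noteq> 0" "\<beta> \<noteq> 0"
    unfolding invertible_det_nz by (auto simp: M det_2)
  then show ?thesis
    using that M N by blast
qed

lemma vbundle_iso_BI:
  assumes "is_B E" "is_B F" "\<alpha> \<noteq> 0" "\<beta> \<noteq> 0"
  shows "vbundle_iso (mat2 [:\<alpha>:] 0 [:u, v:] [:\<beta>:], mat2 [:\<alpha>:] 0 [:v, u:] [:\<beta>:]) E F"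
  using assms unfolding vbundle_iso_def invertible_det_nz
  by (auto simp: det_2 is_B_def mat2_eq_iff mult_mat2_nth field_simps)

section \<open>Normal forms\<close>

text \<open>The gauge rule multiplied by the common denominator \<open>P\<close>. As an identity of
  polynomials it can also be evaluated at the zeros of \<open>P\<close>, where it compares
  residues.\<close>

definition gauge_eq ::
  "complex poly \<Rightarrow> complex poly ^ 2 ^ 2 \<Rightarrow> complex poly ^ 2 ^ 2 \<Rightarrow> complex poly ^ 2 ^ 2 \<Rightarrow> bool" where
  "gauge_eq P M N N' \<longleftrightarrow> (\<forall>i j. P * pderiv (M $ i $ j) + (N' ** M) $ i $ j = (M ** N) $ i $ j)"

lemma gauge_eq_iff:
  assumes "finite S" "\<And>x. x \<notin> S \<Longrightarrow> poly P x \<noteq> 0"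
  shows "gauge_eq P M N N' \<longleftrightarrow> (\<forall>x. x \<notin> S \<longrightarrow>
    evm (pderiv_mat M) x + (\<chi> i j. poly (N' $ i $ j) x / poly P x) ** evm M x =
    evm M x ** (\<chi> i j. poly (N $ i $ j) x / poly P x))"
proof -
  have pointwise: "(evm (pderiv_mat M) x + (\<chi> i j. poly (N' $ i $ j) x / poly P x) ** evm M x =
      evm M x ** (\<chi> i j. poly (N $ i $ j) x / poly P x)) \<longleftrightarrow>
      (\<forall>i j. poly (P * pderiv (M $ i $ j) + (N' ** M) $ i $ j) x = poly ((M ** N) $ i $ j) x)"
    if "x \<notin> S" for x
  proof -
    have "a + (b1 / P' * c1 + b2 / P' * c2) = c3 * (b3 / P') + c4 * (b4 / P') \<longleftrightarrow>
        P' * a + (b1 * c1 + b2 * c2) = c3 * b3 + c4 * b4" if "P' \<noteq> 0" for a b1 b2 b3 b4 c1 c2 c3 c4 P' :: complex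
    proof -
      have "P' * (a + (b1 / P' * c1 + b2 / P' * c2)) = P' * a + (b1 * c1 + b2 * c2)"
        "P' * (c3 * (b3 / P') + c4 * (b4 / P')) = c3 * b3 + c4 * b4"
        using that by (simp_all add: distrib_left)
      then show ?thesis
        using that by (metis mult_left_cancel)
    qed
    then show ?thesis
      using assms(2)[OF that] by (simp add: mult_mat2_nth vec_eq_iff)
  qed
  have "P * pderiv (M $ i $ j) + (N' ** M) $ i $ j = (M ** N) $ i $ j \<longleftrightarrow>
      (\<forall>x. x \<notin> S \<longrightarrow> poly (P * pderiv (M $ i $ j) + (N' ** M) $ i $ j) x = poly ((M ** N) $ i $ j) x)" for i j
    using poly_eq_if_cofinite[OF assms(1)] by metis
  then show ?thesis
    using pointwise unfolding gauge_eq_def by metis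
qed

abbreviation sing_poly_zero :: "complex \<Rightarrow> complex poly" where
  "sing_poly_zero t \<equiv> [:0, t, - (1 + t), 1:]"

abbreviation sing_poly_infty :: "complex \<Rightarrow> complex poly" where
  "sing_poly_infty t \<equiv> [:0, 1, - (1 + t), t:]"

lemma poly_sing_poly_zero: "poly (sing_poly_zero t) x = x * (x - 1) * (x - t)"
  by (simp add: algebra_simps)

lemma poly_sing_poly_infty: "poly (sing_poly_infty t) x = x * (1 - x) * (1 - t * x)"
  by (simp add: algebra_simps)

lemma A_zero_eq: "A_zero t T x = (\<chi> i j. poly (conn_zero T $ i $ j) x / poly (sing_poly_zero t) x)"
  unfolding poly_sing_poly_zero by (simp add: A_zero_def)

lemma A_infty_eq: "A_infty t T w = (\<chi> i j. poly (conn_infty T $ i $ j) w / poly (sing_poly_infty t) w)"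
  unfolding poly_sing_poly_infty by (simp add: A_infty_def)

lemma pconnection_iso_iff:
  assumes "t \<noteq> 0"
  shows "pconnection_iso t \<psi> T T' \<longleftrightarrow> qpbundle_iso t \<psi> T T' \<and>
    gauge_eq (sing_poly_zero t) (fst \<psi>) (conn_zero T) (conn_zero T') \<and>
    gauge_eq (sing_poly_infty t) (snd \<psi>) (conn_infty T) (conn_infty T')"
proof -
  have "poly (sing_poly_zero t) x \<noteq> 0" if "x \<notin> {0, 1, t}" for x
    using that unfolding poly_sing_poly_zero by simp
  moreover have "poly (sing_poly_infty t) x \<noteq> 0" if "x \<notin> {0, 1, 1 / t}" for x
    using that assms unfolding poly_sing_poly_infty by (auto simp: eq_divide_eq mult.commute)
  ultimately show ?thesis
    unfolding pconnection_iso_def A_zero_eq A_infty_eq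
    by (simp only: gauge_eq_iff[of "{0, 1, t}" "sing_poly_zero t"]
        gauge_eq_iff[of "{0, 1, 1 / t}" "sing_poly_infty t"] finite.intros simp_thms)
qed

text \<open>At a zero of the denominator the derivative term of \<open>gauge_eq\<close> drops out,
  so the residues are conjugate under the map of fibres.\<close>

lemma res_conn_gauge:
  assumes "t \<noteq> 0" "t \<noteq> 1"
    and "gauge_eq (sing_poly_zero t) (fst \<psi>) (conn_zero T) (conn_zero T')"
    and "gauge_eq (sing_poly_infty t) (snd \<psi>) (conn_infty T) (conn_infty T')"
  shows "res_conn t T' k ** mat_at \<psi> (sing t k) = mat_at \<psi> (sing t k) ** res_conn t T k"
proof -
  have ev: "evm N' x ** evm M x = evm M x ** evm N x"
    if "gauge_eq P M N N'" "poly P x = 0" for P M N N' x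
    using that unfolding gauge_eq_def evm_mult[symmetric]
    by (metis (no_types, lifting) add_0 evm_nth mult_zero_left poly_add poly_mult vec_eq_iff)
  have scale: "R' ** M = M ** R" if "N' ** M = M ** N" "\<And>i j. R $ i $ j = N $ i $ j / c"
    "\<And>i j. R' $ i $ j = N' $ i $ j / c" for R R' M N N' :: "complex ^ 2 ^ 2" and c
    using that(1) unfolding mat2_eq_iff mult_mat2_nth that(2,3)
    by (simp add: add_divide_distrib[symmetric])
  have z: "poly (sing_poly_zero t) 0 = 0" "poly (sing_poly_zero t) 1 = 0" "poly (sing_poly_zero t) t = 0"
    "poly (sing_poly_infty t) 0 = 0"
    by (simp_all add: algebra_simps)
  have "res_conn t T' k ** mat_at \<psi> (sing t k) = mat_at \<psi> (sing t k) ** res_conn t T k"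
    if "k = 1 \<or> k = 2 \<or> k = 3 \<or> k = 4"
    using that
  proof (elim disjE)
    assume [simp]: "k = 1"
    show ?thesis
      using scale[OF ev[OF assms(3) z(1)], of "res_conn t T 1" t "res_conn t T' 1"]
      by (simp add: res_conn_nth[OF assms(1,2)] mat_at_def sing_def)
  next
    assume [simp]: "k = 2"
    show ?thesis
      using scale[OF ev[OF assms(3) z(2)], of "res_conn t T 2" "1 - t" "res_conn t T' 2"]
      by (simp add: res_conn_nth[OF assms(1,2)] mat_at_def sing_def)
  next
    assume [simp]: "k = 3"
    show ?thesis
      using scale[OF ev[OF assms(3) z(3)], of "res_conn t T 3" "t * (t - 1)" "res_conn t T' 3"]
      by (simp add: res_conn_nth[OF assms(1,2)] mat_at_def sing_def)
  next
    assume [simp]: "k = 4"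
    show ?thesis
      using scale[OF ev[OF assms(4) z(4)], of "res_conn t T 4" 1 "res_conn t T' 4"]
      by (simp add: res_conn_nth[OF assms(1,2)] mat_at_def sing_def)
  qed
  then show ?thesis
    using exhaust_4[of k] by blast
qed

lemma r_minus_neq_r_plus:
  assumes "generic \<kappa>"
  shows "r_minus \<kappa> i \<noteq> r_plus \<kappa> i"
proof -
  have "\<kappa> $ i \<noteq> 0"
    using assms unfolding generic_def by (metis Ints_0)
  then show ?thesis
    by (auto simp: r_minus_def r_plus_def eq_neg_iff_add_eq_0)
qed

lemma is_point_residue:
  assumes "is_point t \<kappa> T" "generic \<kappa>"
  shows "pline T i = eigenspace (res_conn t T i) (r_minus \<kappa> i)"
    and "res_conn t T i $ 1 $ 1 + res_conn t T i $ 2 $ 2 = r_minus \<kappa> i + r_plus \<kappa> i"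
    and "res_conn t T i $ 1 $ 1 * res_conn t T i $ 2 $ 2 - res_conn t T i $ 1 $ 2 * res_conn t T i $ 2 $ 1 =
      r_minus \<kappa> i * r_plus \<kappa> i"
proof -
  have "vec.subspace (pline T i)" "vec.dim (pline T i) = 1"
    "\<And>v. v \<in> pline T i \<Longrightarrow> res_conn t T i *v v = r_minus \<kappa> i *s v"
    "\<And>v. res_conn t T i *v v - r_plus \<kappa> i *s v \<in> pline T i"
    using assms(1) by (simp_all add: is_point_def is_qpbundle_def)
  note * = parabolic_line_imp[OF this r_minus_neq_r_plus[OF assms(2)]]
  show "pline T i = eigenspace (res_conn t T i) (r_minus \<kappa> i)"
    "res_conn t T i $ 1 $ 1 + res_conn t T i $ 2 $ 2 = r_minus \<kappa> i + r_plus \<kappa> i"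
    "res_conn t T i $ 1 $ 1 * res_conn t T i $ 2 $ 2 - res_conn t T i $ 1 $ 2 * res_conn t T i $ 2 $ 1 =
      r_minus \<kappa> i * r_plus \<kappa> i"
    using * by simp_all
qed

text \<open>Compatibility with the parabolic lines is automatic: for generic \<kappa> each line is
  an eigenspace of the residue, and the residues correspond by
  \<open>res_conn_gauge\<close>.\<close>

lemma pconnection_isoI:
  assumes "t \<noteq> 0" "t \<noteq> 1" "generic \<kappa>" "is_point t \<kappa> T" "is_point t \<kappa> T'" "vbundle_iso \<psi> T T'"
    and "gauge_eq (sing_poly_zero t) (fst \<psi>) (conn_zero T) (conn_zero T')"
    and "gauge_eq (sing_poly_infty t) (snd \<psi>) (conn_infty T) (conn_infty T')"
  shows "pconnection_iso t \<psi> T T'"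
proof -
  have "(\<lambda>v. mat_at \<psi> (sing t i) *v v) ` pline T i = pline T' i" for i
  proof -
    have "invertible (mat_at \<psi> (sing t i))"
      using assms(6) by (auto simp: vbundle_iso_def mat_at_def split: proj_line.split)
    then obtain N where "mat_at \<psi> (sing t i) ** N = mat 1" "N ** mat_at \<psi> (sing t i) = mat 1"
      by (auto simp: invertible_def)
    then show ?thesis
      unfolding is_point_residue(1)[OF assms(4,3)] is_point_residue(1)[OF assms(5,3)]
      by (rule image_eigenspace[OF _ _ res_conn_gauge[OF assms(1,2,7,8)]])
  qed
  then show ?thesis
    using assms by (simp add: pconnection_iso_iff qpbundle_iso_def)
qed

text \<open>
  Lagrange interpolation from the determinants of the residues at 0, 1 and \<open>t\<close>; the leading
  coefficient is dictated by the residue at infinity.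
\<close>

definition normal_c :: "complex \<Rightarrow> complex ^ 4 \<Rightarrow> complex \<Rightarrow> complex \<Rightarrow> complex poly" where
  "normal_c t \<kappa> q \<delta> =
     smult (((\<kappa> $ 4)\<^sup>2 - 1) / 4) [:0, t, - (1 + t), 1:] +
     smult (((\<kappa> $ 1 * t / 2)\<^sup>2 - \<delta>\<^sup>2) / ((0 - q) * t)) [:t, - (1 + t), 1:] +
     smult (((\<kappa> $ 2 * (1 - t) / 2)\<^sup>2 - \<delta>\<^sup>2) / ((1 - q) * (1 - t))) [:0, - t, 1:] +
     smult (((\<kappa> $ 3 * (t * (t - 1)) / 2)\<^sup>2 - \<delta>\<^sup>2) / ((t - q) * (t * (t - 1)))) [:0, - 1, 1:]"

lemma normal_c_values:
  assumes "t \<noteq> 0" "t \<noteq> 1" "q \<notin> {0, 1, t}"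
  shows "(0 - q) * poly (normal_c t \<kappa> q \<delta>) 0 = (\<kappa> $ 1 * t / 2)\<^sup>2 - \<delta>\<^sup>2"
    and "(1 - q) * poly (normal_c t \<kappa> q \<delta>) 1 = (\<kappa> $ 2 * (1 - t) / 2)\<^sup>2 - \<delta>\<^sup>2"
    and "(t - q) * poly (normal_c t \<kappa> q \<delta>) t = (\<kappa> $ 3 * (t * (t - 1)) / 2)\<^sup>2 - \<delta>\<^sup>2"
    and "degree (normal_c t \<kappa> q \<delta>) \<le> 3"
    and "coeff (normal_c t \<kappa> q \<delta>) 3 = ((\<kappa> $ 4)\<^sup>2 - 1) / 4"
proof -
  have nz: "0 - q \<noteq> 0" "1 - q \<noteq> 0" "t - q \<noteq> 0" "1 - t \<noteq> 0" "t - 1 \<noteq> 0"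
    using assms by auto
  have canc: "y * (x / (y * z) * z) = x" if "y \<noteq> 0" "z \<noteq> 0" for x y z :: complex
    using that by simp
  have "poly (normal_c t \<kappa> q \<delta>) 0 = ((\<kappa> $ 1 * t / 2)\<^sup>2 - \<delta>\<^sup>2) / ((0 - q) * t) * t"
    unfolding normal_c_def poly_add poly_smult by simp
  then show "(0 - q) * poly (normal_c t \<kappa> q \<delta>) 0 = (\<kappa> $ 1 * t / 2)\<^sup>2 - \<delta>\<^sup>2"
    using canc[OF nz(1) assms(1)] by simp
  have p1: "poly [:0, t, - (1 + t), 1:] 1 = 0" "poly [:t, - (1 + t), 1:] 1 = 0"
    "poly [:0, - t, 1:] 1 = 1 - t" "poly [:0, - 1, 1:] 1 = (0 :: complex)"
    by simp_all
  have "poly (normal_c t \<kappa> q \<delta>) 1 = ((\<kappa> $ 2 * (1 - t) / 2)\<^sup>2 - \<delta>\<^sup>2) / ((1 - q) * (1 - t)) * (1 - t)"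
    unfolding normal_c_def poly_add poly_smult p1 by simp
  then show "(1 - q) * poly (normal_c t \<kappa> q \<delta>) 1 = (\<kappa> $ 2 * (1 - t) / 2)\<^sup>2 - \<delta>\<^sup>2"
    using canc[OF nz(2,4)] by metis
  have pt: "poly [:0, t, - (1 + t), 1:] t = 0" "poly [:t, - (1 + t), 1:] t = 0"
    "poly [:0, - t, 1:] t = 0" "poly [:0, - 1, 1:] t = t * (t - 1)"
    by (simp_all add: algebra_simps)
  have "poly (normal_c t \<kappa> q \<delta>) t =
      ((\<kappa> $ 3 * (t * (t - 1)) / 2)\<^sup>2 - \<delta>\<^sup>2) / ((t - q) * (t * (t - 1))) * (t * (t - 1))"
    unfolding normal_c_def poly_add poly_smult pt by simp
  then show "(t - q) * poly (normal_c t \<kappa> q \<delta>) t = (\<kappa> $ 3 * (t * (t - 1)) / 2)\<^sup>2 - \<delta>\<^sup>2"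
    using canc[OF nz(3), of "t * (t - 1)"] nz(5) assms(1) by (metis mult_eq_0_iff)
  show "degree (normal_c t \<kappa> q \<delta>) \<le> 3"
    unfolding normal_c_def by (intro degree_add_le order.trans[OF degree_smult_le]) auto
  show "coeff (normal_c t \<kappa> q \<delta>) 3 = ((\<kappa> $ 4)\<^sup>2 - 1) / 4"
    unfolding normal_c_def by (simp add: numeral_3_eq_3)
qed

text \<open>Two solutions differ by a polynomial that vanishes at 0, 1, t and has no cubic term,
  hence by zero. The values can be compared because \<open>q\<close> is none of the three
  points.\<close>

lemma normal_c_unique:
  assumes "t \<noteq> 0" "t \<noteq> 1" "q \<notin> {0, 1, t}"
    and "(0 - q) * poly c 0 = (\<kappa> $ 1 * t / 2)\<^sup>2 - \<delta>\<^sup>2"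
    and "(1 - q) * poly c 1 = (\<kappa> $ 2 * (1 - t) / 2)\<^sup>2 - \<delta>\<^sup>2"
    and "(t - q) * poly c t = (\<kappa> $ 3 * (t * (t - 1)) / 2)\<^sup>2 - \<delta>\<^sup>2"
    and "degree c \<le> 3"
    and "coeff c 3 = ((\<kappa> $ 4)\<^sup>2 - 1) / 4"
  shows "c = normal_c t \<kappa> q \<delta>"
proof (rule ccontr)
  define D where "D = c - normal_c t \<kappa> q \<delta>"
  assume "c \<noteq> normal_c t \<kappa> q \<delta>"
  then have "D \<noteq> 0"
    by (simp add: D_def)
  note vals = normal_c_values[OF assms(1-3), where \<kappa> = \<kappa> and \<delta> = \<delta>]
  have "poly c 0 = poly (normal_c t \<kappa> q \<delta>) 0" "poly c 1 = poly (normal_c t \<kappa> q \<delta>) 1"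
    "poly c t = poly (normal_c t \<kappa> q \<delta>) t"
    using assms(3-6) vals(1-3) by (metis insertCI mult_left_cancel right_minus_eq)+
  then have "{0, 1, t} \<subseteq> {x. poly D x = 0}"
    by (simp add: D_def)
  moreover have "finite {x. poly D x = 0}"
    using \<open>D \<noteq> 0\<close> by (rule poly_roots_finite)
  moreover have "card {0, 1, t} = 3"
    using assms by auto
  ultimately have "3 \<le> degree D"
    by (metis card_mono card_poly_roots_bound[OF \<open>D \<noteq> 0\<close>] le_trans)
  moreover have "degree D \<le> 3"
    unfolding D_def using assms(7) vals(4) by (rule degree_diff_le)
  ultimately have "degree D = 3"
    by simp
  then have "coeff D 3 \<noteq> 0"
    using \<open>D \<noteq> 0\<close> by (metis leading_coeff_0_iff)
  then show False
    by (simp add: D_def assms(8) vals(5))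
qed

text \<open>\<open>delta\<close> solves the defining equation of \<open>p\<close> for the value \<open>P(q) A(2,2)\<close> at \<open>x = q\<close>.\<close>

definition delta :: "complex \<Rightarrow> complex ^ 4 \<Rightarrow> complex \<Rightarrow> complex \<Rightarrow> complex" where
  "delta t \<kappa> q p = q * (q - 1) * (q - t) *
     (p - (\<kappa> $ 1 / (2 * q) + \<kappa> $ 2 / (2 * (q - 1)) + \<kappa> $ 3 / (2 * (q - t))))"

text \<open>The matrix at infinity is the one forced by \<open>is_log_connection_B_coeffs\<close>.
  The lines are placeholders: \<open>normal_form\<close> fills in eigenspaces of the residues, which
  depend on the two matrices only.\<close>

definition pre_normal_form :: "complex \<Rightarrow> complex ^ 4 \<Rightarrow> complex \<Rightarrow> complex \<Rightarrow> pconnection" where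
  "pre_normal_form t \<kappa> q \<delta> =
     \<lparr>trans_poly = mat2 1 0 0 [:0, 1:], trans_pole = 0, pline = (\<lambda>_. {}),
      conn_zero = mat2 [:- \<delta>:] [:- q, 1:] (normal_c t \<kappa> q \<delta>) [:\<delta>:],
      conn_infty = mat2 [:0, 0, \<delta>:] [:- 1, q:]
        [:- coeff (normal_c t \<kappa> q \<delta>) 3, - coeff (normal_c t \<kappa> q \<delta>) 2,
          - coeff (normal_c t \<kappa> q \<delta>) 1, - coeff (normal_c t \<kappa> q \<delta>) 0:]
        [:- 1, 1 + t, - \<delta> - t:]\<rparr>"

definition normal_form :: "complex \<Rightarrow> complex ^ 4 \<Rightarrow> complex \<Rightarrow> complex \<Rightarrow> pconnection" where
  "normal_form t \<kappa> q p = (let T = pre_normal_form t \<kappa> q (delta t \<kappa> q p)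
     in T\<lparr>pline := \<lambda>i. eigenspace (res_conn t T i) (r_minus \<kappa> i)\<rparr>)"

section \<open>The normal form is a point of the moduli space\<close>

lemma is_B_normal_form: "is_B (normal_form t \<kappa> q p)"
  by (simp add: is_B_def transition_def normal_form_def pre_normal_form_def Let_def mat2_eq_iff)

lemma conn_normal_form:
  "conn_zero (normal_form t \<kappa> q p) =
     mat2 [:- delta t \<kappa> q p:] [:- q, 1:] (normal_c t \<kappa> q (delta t \<kappa> q p)) [:delta t \<kappa> q p:]"
  "conn_infty (normal_form t \<kappa> q p) =
     mat2 [:0, 0, delta t \<kappa> q p:] [:- 1, q:]
        [:- coeff (normal_c t \<kappa> q (delta t \<kappa> q p)) 3, - coeff (normal_c t \<kappa> q (delta t \<kappa> q p)) 2,
          - coeff (normal_c t \<kappa> q (delta t \<kappa> q p)) 1, - coeff (normal_c t \<kappa> q (delta t \<kappa> q p)) 0:]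
        [:- 1, 1 + t, - delta t \<kappa> q p - t:]"
  by (simp_all add: normal_form_def pre_normal_form_def Let_def)

lemma res_conn_update_pline: "res_conn t (T\<lparr>pline := l\<rparr>) = res_conn t T"
proof -
  have "A_zero t (T\<lparr>pline := l\<rparr>) = A_zero t T" "A_infty t (T\<lparr>pline := l\<rparr>) = A_infty t T"
    by (simp_all add: fun_eq_iff A_zero_def A_infty_def)
  then show ?thesis
    by (intro ext) (simp only: res_conn_def)
qed

lemma pline_normal_form:
  "pline (normal_form t \<kappa> q p) i = eigenspace (res_conn t (normal_form t \<kappa> q p) i) (r_minus \<kappa> i)"
  by (simp add: normal_form_def Let_def res_conn_update_pline)

lemma is_log_connection_normal_form:
  assumes "t \<noteq> 0" "t \<noteq> 1" "q \<notin> {0, 1, t}"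
  shows "is_log_connection t (normal_form t \<kappa> q p)"
proof -
  let ?c = "normal_c t \<kappa> q (delta t \<kappa> q p)"
  have "?c = [:coeff ?c 0, coeff ?c 1, coeff ?c 2, coeff ?c 3:]"
    using normal_c_values(4)[OF assms] by (rule poly_eq_coeffs_3)
  then have "conn_zero (normal_form t \<kappa> q p) = mat2 [:- delta t \<kappa> q p, 0, 0:] [:- q, 1:]
      [:coeff ?c 0, coeff ?c 1, coeff ?c 2, coeff ?c 3:] [:delta t \<kappa> q p, 0, 0:]"
    unfolding conn_normal_form by (metis pCons_0_0)
  moreover have "conn_infty (normal_form t \<kappa> q p) = mat2 [:- 0, - 0, - (- delta t \<kappa> q p):] [:- 1, - (- q):]
      [:- coeff ?c 3, - coeff ?c 2, - coeff ?c 1, - coeff ?c 0:] [:- (0 + 1), 1 + t - 0, - delta t \<kappa> q p - t:]"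
    unfolding conn_normal_form by simp
  ultimately show ?thesis
    unfolding is_log_connection_B_coeffs[OF is_B_normal_form] by blast
qed

text \<open>\<open>normal_c\<close> is interpolated so that exactly these determinants come out. The
  (1,2) entry is nonzero at the finite points because \<open>q\<close> avoids them, and it is -1 at
  infinity.\<close>

lemma normal_form_residue:
  fixes \<kappa> :: "complex ^ 4" and p :: complex
  assumes "t \<noteq> 0" "t \<noteq> 1" "q \<notin> {0, 1, t}"
  defines "R \<equiv> \<lambda>i. res_conn t (normal_form t \<kappa> q p) i"
  shows "R i $ 1 $ 2 \<noteq> 0" "R i $ 1 $ 1 + R i $ 2 $ 2 = r_minus \<kappa> i + r_plus \<kappa> i"
    "R i $ 1 $ 1 * R i $ 2 $ 2 - R i $ 1 $ 2 * R i $ 2 $ 1 = r_minus \<kappa> i * r_plus \<kappa> i"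
proof -
  let ?\<delta> = "delta t \<kappa> q p"
  let ?c = "normal_c t \<kappa> q ?\<delta>"
  note vals = normal_c_values[OF assms(1-3), where \<kappa> = \<kappa> and \<delta> = ?\<delta>]
  note res = res_conn_nth[OF assms(1,2)] conn_normal_form
  have nz: "1 - t \<noteq> 0" "t - 1 \<noteq> 0" "1 - q \<noteq> 0" "t - q \<noteq> 0" "q \<noteq> 0"
    using assms by auto
  \<comment> \<open>Here \<open>d\<close> is \<delta>, \<open>u\<close> is t_i - q, \<open>e\<close>
    is the value of \<open>normal_c\<close> at t_i, \<open>k\<close> is \<kappa>_i, and
    \<open>P\<close> is the derivative of x(x-1)(x-t) at t_i.\<close>
  have det: "(- d / P) * (d / P) - (u / P) * (e / P) = k / 2 * (- k / 2)"
    if "P \<noteq> 0" "u * e = (k * P / 2)\<^sup>2 - d\<^sup>2" for u e d k P :: complex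
  proof -
    have "(- d / P) * (d / P) - (u / P) * (e / P) = - (d\<^sup>2 + u * e) / P\<^sup>2"
      using that(1) by (simp add: field_simps power2_eq_square)
    also have "\<dots> = k / 2 * (- k / 2)"
      unfolding that(2) using that(1) by (simp add: field_simps power2_eq_square)
    finally show ?thesis .
  qed
  have "R i $ 1 $ 2 \<noteq> 0 \<and> R i $ 1 $ 1 + R i $ 2 $ 2 = r_minus \<kappa> i + r_plus \<kappa> i \<and>
    R i $ 1 $ 1 * R i $ 2 $ 2 - R i $ 1 $ 2 * R i $ 2 $ 1 = r_minus \<kappa> i * r_plus \<kappa> i"
    if "i = 1 \<or> i = 2 \<or> i = 3 \<or> i = 4"
    using that
  proof (elim disjE)
    assume [simp]: "i = 1"
    show ?thesis
      using nz assms(1) det[OF assms(1) vals(1)]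
      by (simp add: R_def res r_minus_def r_plus_def)
  next
    assume [simp]: "i = 2"
    show ?thesis
      using nz det[OF nz(1) vals(2)]
      by (simp add: R_def res r_minus_def r_plus_def)
  next
    assume [simp]: "i = 3"
    have "t * (t - 1) \<noteq> 0"
      using nz assms(1) by simp
    then show ?thesis
      using nz assms(1) det[OF _ vals(3)]
      by (simp add: R_def res r_minus_def r_plus_def)
  next
    assume [simp]: "i = 4"
    show ?thesis
      by (simp add: R_def res r_minus_def r_plus_def vals(5)) (simp add: field_simps power2_eq_square)
  qed
  then show "R i $ 1 $ 2 \<noteq> 0" "R i $ 1 $ 1 + R i $ 2 $ 2 = r_minus \<kappa> i + r_plus \<kappa> i"
    "R i $ 1 $ 1 * R i $ 2 $ 2 - R i $ 1 $ 2 * R i $ 2 $ 1 = r_minus \<kappa> i * r_plus \<kappa> i"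
    using exhaust_4[of i] by blast+
qed

lemma is_point_normal_form:
  assumes "t \<noteq> 0" "t \<noteq> 1" "q \<notin> {0, 1, t}"
  shows "is_point t \<kappa> (normal_form t \<kappa> q p)"
proof -
  note E = parabolic_line_eigenspace[OF normal_form_residue[OF assms]]
  show ?thesis
    unfolding is_point_def is_qpbundle_def pline_normal_form
    using E(2-4) is_vbundle_B[OF is_B_normal_form] is_log_connection_normal_form[OF assms]
    by (simp add: eigenspace_def)
qed

text \<open>A diagonal gauge makes the (1,2) entry monic, and a lower triangular one makes the (2,2)
  entry constant, equal to its old value at \<open>q\<close>. The traces of the residues then fix
  the (1,1) entry and their determinants the (2,1) entry.\<close>

lemma iso_normal_form:
  assumes "t \<noteq> 0" "t \<noteq> 1" "q \<notin> {0, 1, t}" "generic \<kappa>"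
    and T: "is_point t \<kappa> T" "is_B T" "conn_zero T $ 1 $ 2 \<noteq> 0" "poly (conn_zero T $ 1 $ 2) q = 0"
  obtains p \<psi> where "pconnection_iso t \<psi> T (normal_form t \<kappa> q p)"
proof -
  obtain a0 a1 a2 b0 b1 c0 c1 c2 c3 d0 d1 d2 where
    N: "conn_zero T = mat2 [:a0, a1, a2:] [:b0, b1:] [:c0, c1, c2, c3:] [:d0, d1, d2:]"
      "conn_infty T = mat2 [:- a2, - a1, - a0:] [:- b1, - b0:] [:- c3, - c2, - c1, - c0:]
        [:- (d2 + 1), 1 + t - d1, - d0 - t:]"
    using T(1) is_log_connection_B_coeffs[OF T(2)] by (auto simp: is_point_def)
  have b0: "b0 = - b1 * q" and b1: "b1 \<noteq> 0"
    using T(3,4) by (auto simp: N add_eq_0_iff mult.commute)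
  have nz: "1 - t \<noteq> 0" "t - 1 \<noteq> 0"
    using assms by auto
  note tr = is_point_residue(2)[OF T(1) assms(4)]
  note dt = is_point_residue(3)[OF T(1) assms(4)]
  note res = res_conn_nth[OF assms(1,2)] N r_minus_def r_plus_def
  \<comment> \<open>The trace of the numerator matrix is a quadratic polynomial that vanishes at 0,
    1 and t, so it is zero.\<close>
  have "a0 + d0 = 0" "a0 + a1 + a2 + (d0 + d1 + d2) = 0"
      "(a0 + t * (a1 + t * a2)) + (d0 + t * (d1 + t * d2)) = 0"
    using tr[of 1] tr[of 2] tr[of 3] nz assms(1)
    by (simp_all add: res add_divide_distrib[symmetric] add.assoc)
  then have a0: "a0 = - d0" and s: "(a1 + d1) + (a2 + d2) = 0" "t * ((a1 + d1) + t * (a2 + d2)) = 0"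
    by algebra+
  have "(a1 + d1) + t * (a2 + d2) = 0"
    using s(2) assms(1) by simp
  with s(1) have "(1 - t) * (a2 + d2) = 0"
    by algebra
  then have "a2 + d2 = 0"
    using nz by simp
  with s(1) have a1: "a1 = - d1" and a2: "a2 = - d2"
    by (simp_all add: eq_neg_iff_add_eq_0)
  note a = a0 a1 a2
  have det: "d\<^sup>2 + u * e = (k * P / 2)\<^sup>2"
    if "P \<noteq> 0" "(- d / P) * (d / P) - (u / P) * (e / P) = k / 2 * (- k / 2)" for u e d k P :: complex
  proof -
    have "(- d / P) * (d / P) - (u / P) * (e / P) = - (d\<^sup>2 + u * e) / P\<^sup>2"
      using that(1) by (simp add: field_simps power2_eq_square)
    then have "- (d\<^sup>2 + u * e) / P\<^sup>2 = k / 2 * (- k / 2)"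
      using that(2) by simp
    then show ?thesis
      using that(1) by (simp add: field_simps power2_eq_square)
  qed
  let ?d = "\<lambda>x. d0 + x * (d1 + x * d2)" and ?c = "\<lambda>x. c0 + x * (c1 + x * (c2 + x * c3))"
    and ?b = "\<lambda>x. b0 + x * b1"
  have D: "(?d 0)\<^sup>2 + ?b 0 * ?c 0 = (\<kappa> $ 1 * t / 2)\<^sup>2"
    "(?d 1)\<^sup>2 + ?b 1 * ?c 1 = (\<kappa> $ 2 * (1 - t) / 2)\<^sup>2"
    "(?d t)\<^sup>2 + ?b t * ?c t = (\<kappa> $ 3 * (t * (t - 1)) / 2)\<^sup>2"
    subgoal by (rule det[OF assms(1)]) (use dt[of 1] in \<open>simp add: res a\<close>)
    subgoal by (rule det[OF nz(1)]) (use dt[of 2] in \<open>simp add: res a algebra_simps\<close>)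
    subgoal by (rule det) (use dt[of 3] nz assms(1) in \<open>simp_all add: res a algebra_simps\<close>)
    done
  \<comment> \<open>The residue at infinity has diagonal entries d2 and -(d2 + 1), whence the linear
    term.\<close>
  have D4: "d2\<^sup>2 + d2 + b1 * c3 = ((\<kappa> $ 4)\<^sup>2 - 1) / 4"
    using dt[of 4] by (simp add: res a field_simps power2_eq_square)
  define \<delta> where "\<delta> = ?d q"
  \<comment> \<open>The equation \<open>delta t \<kappa> q p = \<delta>\<close> solved for
    \<open>p\<close>.\<close>
  define p where "p = \<delta> / (q * (q - 1) * (q - t)) +
    (\<kappa> $ 1 / (2 * q) + \<kappa> $ 2 / (2 * (q - 1)) + \<kappa> $ 3 / (2 * (q - t)))"
  have delta: "delta t \<kappa> q p = \<delta>"
    using assms(3) by (simp add: delta_def p_def)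
  \<comment> \<open>\<open>u + v x = (\<delta> - d(x)) / (x - q)\<close>, chosen to make the (2,2) entry constant\<close>
  define u v where "u = - (d1 + d2 * q)" "v = - d2"
  note uv = this
  \<comment> \<open>The coefficients of the transformed (2,1) entry -(u + v x)(d(x) + \<delta>) + b1
    c(x) - v x(x-1)(x-t); the last summand comes from the derivative of the gauge.\<close>
  define e0 e1 e2 e3 where
    "e0 = - u * (d0 + \<delta>) + b1 * c0"
    "e1 = - u * d1 - v * (d0 + \<delta>) + b1 * c1 - v * t"
    "e2 = - u * d2 - v * d1 + b1 * c2 + v * (1 + t)"
    "e3 = - v * d2 + b1 * c3 - v"
  note e = this
  \<comment> \<open>Multiplied by x - q, the new entry is expressed through d^2 + b c, minus the old
    determinant. At 0, 1 and t the last term vanishes, and \<open>D\<close> yields the interpolation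
    conditions.\<close>
  have key: "(x - q) * (e0 + x * (e1 + x * (e2 + x * e3))) =
      (?d x)\<^sup>2 + ?b x * ?c x - \<delta>\<^sup>2 - (x - q) * v * (x * (x - 1) * (x - t))" for x
    unfolding e uv \<delta>_def b0 by algebra
  have "e3 = ((\<kappa> $ 4)\<^sup>2 - 1) / 4"
    using D4 by (simp add: e(4) uv(2) power2_eq_square algebra_simps)
  then have "[:e0, e1, e2, e3:] = normal_c t \<kappa> q \<delta>"
    using D key[of 0] key[of 1] key[of t]
    by (intro normal_c_unique[OF assms(1-3)]) (simp_all add: numeral_3_eq_3)
  note c = this[symmetric]
  have NF: "conn_zero (normal_form t \<kappa> q p) = mat2 [:- \<delta>:] [:- q, 1:] [:e0, e1, e2, e3:] [:\<delta>:]"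
    "conn_infty (normal_form t \<kappa> q p) = mat2 [:0, 0, \<delta>:] [:- 1, q:]
        [:- e3, - e2, - e1, - e0:] [:- 1, 1 + t, - \<delta> - t:]"
    by (simp_all add: conn_normal_form delta c numeral_3_eq_3 numeral_2_eq_2)
  let ?\<psi> = "(mat2 [:1:] 0 [:u, v:] [:b1:], mat2 [:1:] 0 [:v, u:] [:b1:])"
  have "vbundle_iso ?\<psi> T (normal_form t \<kappa> q p)"
    using T(2) is_B_normal_form b1 by (intro vbundle_iso_BI) auto
  moreover have "gauge_eq (sing_poly_zero t) (fst ?\<psi>) (conn_zero T) (conn_zero (normal_form t \<kappa> q p))"
    unfolding gauge_eq_def forall_2 NF N
    by (simp add: mult_mat2_nth e uv a b0 \<delta>_def pderiv_pCons algebra_simps)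
  moreover have "gauge_eq (sing_poly_infty t) (snd ?\<psi>) (conn_infty T) (conn_infty (normal_form t \<kappa> q p))"
    unfolding gauge_eq_def forall_2 NF N
    by (simp add: mult_mat2_nth e uv a b0 \<delta>_def pderiv_pCons algebra_simps)
  ultimately have "pconnection_iso t ?\<psi> T (normal_form t \<kappa> q p)"
    using assms T is_point_normal_form by (intro pconnection_isoI)
  then show ?thesis
    using that by blast
qed

text \<open>This makes \<open>q\<close> and \<open>p\<close> well defined on a class. By
  \<open>vbundle_iso_B\<close> the isomorphism is lower triangular, so it only rescales the (1,2)
  entry; it changes the (2,2) entry by a multiple of x - q, which does not affect the value at
  \<open>q\<close>.\<close>

lemma normal_form_iso_coords:
  assumes "t \<noteq> 0" "is_B T" "pconnection_iso t \<psi> (normal_form t \<kappa> q p) T"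
  obtains k where "k \<noteq> 0" "conn_zero T $ 1 $ 2 = smult k [:- q, 1:]"
    "conn_infty T $ 1 $ 2 = smult k [:- 1, q:]" "poly (conn_zero T $ 2 $ 2) q = delta t \<kappa> q p"
proof -
  have iso: "vbundle_iso \<psi> (normal_form t \<kappa> q p) T"
    and z: "gauge_eq (sing_poly_zero t) (fst \<psi>) (conn_zero (normal_form t \<kappa> q p)) (conn_zero T)"
    and w: "gauge_eq (sing_poly_infty t) (snd \<psi>) (conn_infty (normal_form t \<kappa> q p)) (conn_infty T)"
    using assms by (simp_all add: pconnection_iso_iff qpbundle_iso_def)
  obtain \<alpha> \<beta> u v where ab: "\<alpha> \<noteq> 0" "\<beta> \<noteq> 0"
    "fst \<psi> = mat2 [:\<alpha>:] 0 [:u, v:] [:\<beta>:]" "snd \<psi> = mat2 [:\<alpha>:] 0 [:v, u:] [:\<beta>:]"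
    using vbundle_iso_B[OF is_B_normal_form assms(2) iso] .
  have "smult \<beta> (conn_zero T $ 1 $ 2) = smult \<alpha> [:- q, 1:]"
    "smult \<beta> (conn_infty T $ 1 $ 2) = smult \<alpha> [:- 1, q:]"
    using z w unfolding gauge_eq_def forall_2 mult_mat2_nth ab(3,4) conn_normal_form
    by (simp_all add: mult.commute)
  then have "smult (1 / \<beta>) (smult \<beta> (conn_zero T $ 1 $ 2)) = smult (1 / \<beta>) (smult \<alpha> [:- q, 1:])"
    "smult (1 / \<beta>) (smult \<beta> (conn_infty T $ 1 $ 2)) = smult (1 / \<beta>) (smult \<alpha> [:- 1, q:])"
    by simp_all
  then have "conn_zero T $ 1 $ 2 = smult (\<alpha> / \<beta>) [:- q, 1:]" "conn_infty T $ 1 $ 2 = smult (\<alpha> / \<beta>) [:- 1, q:]"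
    using ab(2) by simp_all
  moreover have "poly (conn_zero T $ 2 $ 2) q = delta t \<kappa> q p"
  proof -
    have "poly (conn_zero T $ 2 $ 2 * [:\<beta>:]) q = poly ([:u, v:] * [:- q, 1:] + [:\<beta>:] * [:delta t \<kappa> q p:]) q"
      using z unfolding gauge_eq_def forall_2 mult_mat2_nth ab(3,4) conn_normal_form
      by simp
    then show ?thesis
      using ab(2) by simp
  qed
  ultimately show ?thesis
    using ab that by (metis divide_eq_0_iff)
qed

section \<open>Coordinates on the moduli space\<close>

definition normal_class :: "complex \<Rightarrow> complex ^ 4 \<Rightarrow> complex \<Rightarrow> complex \<Rightarrow> pconnection set" where
  "normal_class t \<kappa> q p = point_rel t \<kappa> `` {normal_form t \<kappa> q p}"

lemma normal_form_in_class:
  assumes "t \<noteq> 0" "t \<noteq> 1" "q \<notin> {0, 1, t}"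
  shows "normal_form t \<kappa> q p \<in> normal_class t \<kappa> q p"
  using is_point_normal_form[OF assms] pconnection_iso_refl
  unfolding normal_class_def point_rel_def by blast

lemma normal_class_iso:
  assumes "T \<in> normal_class t \<kappa> q p"
  obtains \<psi> where "pconnection_iso t \<psi> (normal_form t \<kappa> q p) T"
  using assms unfolding normal_class_def point_rel_def by blast

lemma is_apparent_sing_normal_class:
  assumes "t \<noteq> 0" "t \<noteq> 1" "q \<notin> {0, 1, t}"
  shows "is_apparent_sing (normal_class t \<kappa> q p) z \<longleftrightarrow> z = Fin q"
proof
  assume "is_apparent_sing (normal_class t \<kappa> q p) z"
  then obtain T where T: "is_B T" "T \<in> normal_class t \<kappa> q p"
    "mat_at (conn_zero T, conn_infty T) z $ 1 $ 2 = 0"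
    unfolding is_apparent_sing_def by blast
  obtain \<psi> where iso: "pconnection_iso t \<psi> (normal_form t \<kappa> q p) T"
    using T(2) by (rule normal_class_iso)
  obtain k where "k \<noteq> 0" "conn_zero T $ 1 $ 2 = smult k [:- q, 1:]"
    "conn_infty T $ 1 $ 2 = smult k [:- 1, q:]"
    using normal_form_iso_coords[OF assms(1) T(1) iso] .
  then show "z = Fin q"
    using T(3) by (cases z) (auto simp: mat_at_def)
next
  assume "z = Fin q"
  then show "is_apparent_sing (normal_class t \<kappa> q p) z"
    unfolding is_apparent_sing_def
    by (intro bexI[OF _ normal_form_in_class[OF assms]])
      (simp add: is_B_normal_form conn_normal_form mat_at_def)
qed

lemma apparent_sing_normal_class:
  assumes "t \<noteq> 0" "t \<noteq> 1" "q \<notin> {0, 1, t}"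
  shows "apparent_sing (normal_class t \<kappa> q p) = Fin q"
  by (simp add: apparent_sing_def is_apparent_sing_normal_class[OF assms])

lemma p_coord_normal_class:
  assumes "t \<noteq> 0" "t \<noteq> 1" "q \<notin> {0, 1, t}"
  shows "p_coord t \<kappa> (normal_class t \<kappa> q p) = p"
proof -
  define S where "S = \<kappa> $ 1 / (2 * q) + \<kappa> $ 2 / (2 * (q - 1)) + \<kappa> $ 3 / (2 * (q - t))"
  have p: "delta t \<kappa> q p / (q * (q - 1) * (q - t)) = p - S"
    using assms(3) by (simp add: delta_def S_def)
  show ?thesis
    unfolding p_coord_def
  proof (rule the_equality)
    have "A_zero t (normal_form t \<kappa> q p) x $ 1 $ 2 = (x - q) / (x * (x - 1) * (x - t))" for x
      by (simp add: A_zero_def conn_normal_form)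
    moreover have "p = A_zero t (normal_form t \<kappa> q p) q $ 2 $ 2 +
        \<kappa> $ 1 / (2 * q) + \<kappa> $ 2 / (2 * (q - 1)) + \<kappa> $ 3 / (2 * (q - t))"
      using p by (simp add: A_zero_def conn_normal_form S_def)
    ultimately show "\<exists>T\<in>normal_class t \<kappa> q p. \<exists>q. is_B T \<and> q \<notin> {0, 1, t} \<and>
       (\<forall>x. x \<notin> {0, 1, t} \<longrightarrow> A_zero t T x $ 1 $ 2 = (x - q) / (x * (x - 1) * (x - t))) \<and>
       p = A_zero t T q $ 2 $ 2 + \<kappa> $ 1 / (2 * q) + \<kappa> $ 2 / (2 * (q - 1)) + \<kappa> $ 3 / (2 * (q - t))"
      using assms(3) is_B_normal_form
      by (intro bexI[OF _ normal_form_in_class[OF assms]] exI[of _ q]) blast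
  next
    fix p' assume "\<exists>T\<in>normal_class t \<kappa> q p. \<exists>q. is_B T \<and> q \<notin> {0, 1, t} \<and>
       (\<forall>x. x \<notin> {0, 1, t} \<longrightarrow> A_zero t T x $ 1 $ 2 = (x - q) / (x * (x - 1) * (x - t))) \<and>
       p' = A_zero t T q $ 2 $ 2 + \<kappa> $ 1 / (2 * q) + \<kappa> $ 2 / (2 * (q - 1)) + \<kappa> $ 3 / (2 * (q - t))"
    then obtain T r where T: "T \<in> normal_class t \<kappa> q p" "is_B T"
      "\<And>x. x \<notin> {0, 1, t} \<Longrightarrow> A_zero t T x $ 1 $ 2 = (x - r) / (x * (x - 1) * (x - t))"
      "p' = A_zero t T r $ 2 $ 2 + \<kappa> $ 1 / (2 * r) + \<kappa> $ 2 / (2 * (r - 1)) + \<kappa> $ 3 / (2 * (r - t))"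
      by blast
    obtain \<psi> where "pconnection_iso t \<psi> (normal_form t \<kappa> q p) T"
      using T(1) by (rule normal_class_iso)
    then obtain k where k: "conn_zero T $ 1 $ 2 = smult k [:- q, 1:]"
      "poly (conn_zero T $ 2 $ 2) q = delta t \<kappa> q p"
      using normal_form_iso_coords[OF assms(1) T(2)] by metis
    \<comment> \<open>The prescribed form of the (1,2) entry makes x - r a multiple of x -
      q.\<close>
    have "conn_zero T $ 1 $ 2 = [:- r, 1:]"
    proof (rule poly_eq_if_cofinite[of "{0, 1, t}"])
      fix x assume "x \<notin> {0, 1, t}"
      then show "poly (conn_zero T $ 1 $ 2) x = poly [:- r, 1:] x"
        using T(3)[of x] by (simp add: A_zero_def)
    qed simp
    then have "r = q"
      using k(1) by auto
    then show "p' = p"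
      using T(4) p k(2) by (simp add: A_zero_def S_def)
  qed
qed

text \<open>Every class in the chart contains a normal form by \<open>iso_normal_form\<close>.
  Together with \<open>family_coords_normal_class\<close> this shows that points of the chart
  correspond to their coordinates.\<close>

lemma family_chart_iff:
  assumes "t \<noteq> 0" "t \<noteq> 1"
  shows "(\<kappa>, m) \<in> family_chart t \<longleftrightarrow>
    generic \<kappa> \<and> (\<exists>q p. q \<notin> {0, 1, t} \<and> m = normal_class t \<kappa> q p)"
proof
  assume "(\<kappa>, m) \<in> family_chart t"
  then obtain q T where g: "generic \<kappa>" and m: "m \<in> {T. is_point t \<kappa> T} // point_rel t \<kappa>"
    and q: "q \<notin> {0, 1, t}" and T: "T \<in> m" "is_B T" "conn_zero T $ 1 $ 2 \<noteq> 0"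
      "poly (conn_zero T $ 1 $ 2) q = 0"
    by (auto simp: family_chart_def is_apparent_sing_def moduli_eq mat_at_def)
  obtain T0 where T0: "m = point_rel t \<kappa> `` {T0}" "(T0, T) \<in> point_rel t \<kappa>"
    using m T(1) by (auto elim: quotientE)
  then have "is_point t \<kappa> T"
    by (simp add: point_rel_def)
  then obtain p \<psi> where "pconnection_iso t \<psi> T (normal_form t \<kappa> q p)"
    using iso_normal_form[OF assms q g _ T(2-4)] by blast
  then have "(T, normal_form t \<kappa> q p) \<in> point_rel t \<kappa>"
    using \<open>is_point t \<kappa> T\<close> is_point_normal_form[OF assms q] unfolding point_rel_def by blast
  then have "m = normal_class t \<kappa> q p"
    using T0 equiv_class_eq[OF equiv_point_rel] unfolding normal_class_def by metis
  then show "generic \<kappa> \<and> (\<exists>q p. q \<notin> {0, 1, t} \<and> m = normal_class t \<kappa> q p)"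
    using g q by blast
next
  assume "generic \<kappa> \<and> (\<exists>q p. q \<notin> {0, 1, t} \<and> m = normal_class t \<kappa> q p)"
  then obtain q p where "generic \<kappa>" and q: "q \<notin> {0, 1, t}" and m: "m = normal_class t \<kappa> q p"
    by blast
  moreover have "m \<in> moduli t \<kappa>"
    unfolding m normal_class_def moduli_eq
    by (rule quotientI) (use is_point_normal_form[OF assms q] in simp)
  moreover have "is_apparent_sing m (Fin q)"
    using is_apparent_sing_normal_class[OF assms q] m by simp
  ultimately show "(\<kappa>, m) \<in> family_chart t"
    by (auto simp: family_chart_def)
qed

lemma family_coords_normal_class:
  assumes "t \<noteq> 0" "t \<noteq> 1" "q \<notin> {0, 1, t}"
  shows "family_coords t (\<kappa>, normal_class t \<kappa> q p) = (\<kappa>, q, p)"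
  by (simp add: apparent_sing_normal_class[OF assms] p_coord_normal_class[OF assms])

section \<open>The parabolic parameter\<close>

text \<open>The left side is the leading coefficient of the quadratic that interpolates the second
  coordinates of the parabolic lines over the first coordinate m0 + m1 x. Writing m0 + m1 s = m1 (s
  - q) + (m0 + m1 q) at each point s reduces it to partial fraction sums, and the definition of
  \<open>delta\<close> cancels the remaining \<kappa>-terms against those in p.\<close>

lemma lagrange_sum_delta:
  fixes \<kappa> :: "complex ^ 4" and p :: complex
  assumes "t \<noteq> 0" "t \<noteq> 1" "q \<notin> {0, 1, t}"
  defines "\<delta> \<equiv> delta t \<kappa> q p"
  shows "(\<kappa> $ 1 * t / 2 + \<delta>) * m0 / ((0 - q) * t) +
    (\<kappa> $ 2 * (1 - t) / 2 + \<delta>) * (m0 + m1) / ((1 - q) * (1 - t)) +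
    (\<kappa> $ 3 * (t * (t - 1)) / 2 + \<delta>) * (m0 + m1 * t) / ((t - q) * (t * (t - 1))) =
    m1 * (\<kappa> $ 1 + \<kappa> $ 2 + \<kappa> $ 3) / 2 - (m0 + m1 * q) * p"
proof -
  have nz: "0 - q \<noteq> 0" "1 - q \<noteq> 0" "t - q \<noteq> 0" "1 - t \<noteq> 0" "t - 1 \<noteq> 0" "q \<noteq> 0" "q - 1 \<noteq> 0" "q - t \<noteq> 0"
    using assms by auto
  have summand: "(k * P / 2 + \<delta>) * (m0 + m1 * s) / ((s - q) * P) =
      m1 * k / 2 + m1 * \<delta> * (1 / P) + (m0 + m1 * q) * \<delta> * (1 / (P * (s - q))) -
      (m0 + m1 * q) * (k / (2 * (q - s)))" if "P \<noteq> 0" "s - q \<noteq> 0" for k P s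
  proof -
    have flip: "k / (2 * (q - s)) = - (k / (2 * (s - q)))"
      by (metis minus_diff_eq minus_divide_right mult_minus_right)
    have split: "m0 + m1 * s = m1 * (s - q) + (m0 + m1 * q)"
      by (simp add: algebra_simps)
    have "(k * P / 2 + \<delta>) * (m1 * r + a) / (r * P) =
        m1 * k / 2 + m1 * \<delta> * (1 / P) + a * \<delta> * (1 / (P * r)) - a * - (k / (2 * r))" if "r \<noteq> 0" for r a
      using that \<open>P \<noteq> 0\<close> by (simp add: field_simps)
    from this[OF that(2)] show ?thesis
      unfolding flip split .
  qed
  \<comment> \<open>For the cubic P = x(x-1)(x-t), the sum of 1/P' over the zeros of P is 0.\<close>
  have "1 / t + 1 / (1 - t) + 1 / (t * (t - 1)) = 0"
  proof -
    have "1 / t + 1 / (1 - t) + 1 / (t * (t - 1)) = (1 - t + t - 1) / (t * (1 - t))"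
      using nz assms(1) by (simp add: divide_simps)
    then show ?thesis
      by simp
  qed
  then have s1: "1 / (t * (t - 1)) = - 1 / t - 1 / (1 - t)"
    by (simp add: algebra_simps add_eq_0_iff)
  \<comment> \<open>The partial fraction expansion of 1/P at \<open>q\<close>, with the sign
    reversed.\<close>
  have s2: "1 / (t * (0 - q)) + 1 / ((1 - t) * (1 - q)) + 1 / (t * (t - 1) * (t - q)) =
      - 1 / (q * (q - 1) * (q - t))"
    using nz assms(1) by (simp add: divide_simps) (simp add: algebra_simps)
  define S where "S = \<kappa> $ 1 / (2 * (q - 0)) + \<kappa> $ 2 / (2 * (q - 1)) + \<kappa> $ 3 / (2 * (q - t))"
  have p: "\<delta> * (- 1 / (q * (q - 1) * (q - t))) = S - p"
    using nz by (simp add: \<delta>_def delta_def S_def)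
  have "t * (t - 1) \<noteq> 0"
    using nz assms(1) by simp
  have "(\<kappa> $ 1 * t / 2 + \<delta>) * (m0 + m1 * 0) / ((0 - q) * t) +
    (\<kappa> $ 2 * (1 - t) / 2 + \<delta>) * (m0 + m1 * 1) / ((1 - q) * (1 - t)) +
    (\<kappa> $ 3 * (t * (t - 1)) / 2 + \<delta>) * (m0 + m1 * t) / ((t - q) * (t * (t - 1))) =
    m1 * (\<kappa> $ 1 + \<kappa> $ 2 + \<kappa> $ 3) / 2 + m1 * \<delta> * (1 / t + 1 / (1 - t) + 1 / (t * (t - 1))) +
    (m0 + m1 * q) * (\<delta> * (1 / (t * (0 - q)) + 1 / ((1 - t) * (1 - q)) + 1 / (t * (t - 1) * (t - q)))) -
    (m0 + m1 * q) * S"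
    unfolding summand[OF assms(1) nz(1)] summand[OF nz(4,2)] summand[OF \<open>t * (t - 1) \<noteq> 0\<close> nz(3)] S_def
    by (simp only: distrib_left distrib_right add_divide_distrib mult.assoc) (simp add: algebra_simps)
  also have "\<dots> = m1 * (\<kappa> $ 1 + \<kappa> $ 2 + \<kappa> $ 3) / 2 - (m0 + m1 * q) * p"
    unfolding s2 p using s1 by (simp add: algebra_simps)
  finally show ?thesis
    by simp
qed

text \<open>The equation from \<open>parabolic_line_eigenspace\<close> solved for the second
  coordinate, so that the conditions at 0, 1, t become interpolation conditions.\<close>

lemma pline_normal_form_iff:
  fixes \<kappa> :: "complex ^ 4" and p :: complex
  assumes "t \<noteq> 0" "t \<noteq> 1" "q \<notin> {0, 1, t}"
  defines "\<delta> \<equiv> delta t \<kappa> q p"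
  shows "v \<in> pline (normal_form t \<kappa> q p) 1 \<longleftrightarrow> v $ 2 = (\<kappa> $ 1 * t / 2 + \<delta>) * v $ 1 / (0 - q)"
    and "v \<in> pline (normal_form t \<kappa> q p) 2 \<longleftrightarrow> v $ 2 = (\<kappa> $ 2 * (1 - t) / 2 + \<delta>) * v $ 1 / (1 - q)"
    and "v \<in> pline (normal_form t \<kappa> q p) 3 \<longleftrightarrow> v $ 2 = (\<kappa> $ 3 * (t * (t - 1)) / 2 + \<delta>) * v $ 1 / (t - q)"
    and "v \<in> pline (normal_form t \<kappa> q p) 4 \<longleftrightarrow> v $ 2 = (1 - \<kappa> $ 4) / 2 * v $ 1"
proof -
  have nz: "0 - q \<noteq> 0" "1 - q \<noteq> 0" "t - q \<noteq> 0" "1 - t \<noteq> 0" "t - 1 \<noteq> 0" "t * (t - 1) \<noteq> 0"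
    using assms by auto
  note E = parabolic_line_eigenspace(1)[OF normal_form_residue[OF assms(1-3)]]
  have fin: "s / P * y = (k / 2 - - d / P) * x \<longleftrightarrow> y = (k * P / 2 + d) * x / s"
    if "s \<noteq> 0" "P \<noteq> 0" for s P k d x y :: complex
    using that by (simp add: field_simps)
  show "v \<in> pline (normal_form t \<kappa> q p) 1 \<longleftrightarrow> v $ 2 = (\<kappa> $ 1 * t / 2 + \<delta>) * v $ 1 / (0 - q)"
    unfolding pline_normal_form E mem_Collect_eq \<delta>_def fin[OF nz(1) assms(1), symmetric]
    by (simp add: res_conn_nth[OF assms(1,2)] conn_normal_form r_minus_def)
  show "v \<in> pline (normal_form t \<kappa> q p) 2 \<longleftrightarrow> v $ 2 = (\<kappa> $ 2 * (1 - t) / 2 + \<delta>) * v $ 1 / (1 - q)"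
    unfolding pline_normal_form E mem_Collect_eq \<delta>_def fin[OF nz(2,4), symmetric]
    by (simp add: res_conn_nth[OF assms(1,2)] conn_normal_form r_minus_def)
  show "v \<in> pline (normal_form t \<kappa> q p) 3 \<longleftrightarrow> v $ 2 = (\<kappa> $ 3 * (t * (t - 1)) / 2 + \<delta>) * v $ 1 / (t - q)"
    unfolding pline_normal_form E mem_Collect_eq \<delta>_def fin[OF nz(3,6), symmetric]
    by (simp add: res_conn_nth[OF assms(1,2)] conn_normal_form r_minus_def)
  have "- y = (k / 2 - 1 / 2) * x \<longleftrightarrow> y = (1 - k) / 2 * x" for y k x :: complex
    by (simp add: field_simps) (metis minus_diff_eq minus_equation_iff mult_minus_right)
  then show "v \<in> pline (normal_form t \<kappa> q p) 4 \<longleftrightarrow> v $ 2 = (1 - \<kappa> $ 4) / 2 * v $ 1"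
    unfolding pline_normal_form E mem_Collect_eq
    by (simp add: res_conn_nth[OF assms(1,2)] conn_normal_form r_minus_def)
qed

lemma vec_at_pline_normal_form_iff:
  fixes \<kappa> :: "complex ^ 4" and p :: complex
  assumes "t \<noteq> 0" "t \<noteq> 1" "q \<notin> {0, 1, t}"
  defines "\<delta> \<equiv> delta t \<kappa> q p"
  shows "(\<forall>i. vec_at \<phi> (sing t i) \<in> pline (normal_form t \<kappa> q p) i) \<longleftrightarrow>
    poly (fst \<phi> $ 2) 0 = (\<kappa> $ 1 * t / 2 + \<delta>) * poly (fst \<phi> $ 1) 0 / (0 - q) \<and>
    poly (fst \<phi> $ 2) 1 = (\<kappa> $ 2 * (1 - t) / 2 + \<delta>) * poly (fst \<phi> $ 1) 1 / (1 - q) \<and>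
    poly (fst \<phi> $ 2) t = (\<kappa> $ 3 * (t * (t - 1)) / 2 + \<delta>) * poly (fst \<phi> $ 1) t / (t - q) \<and>
    poly (snd \<phi> $ 2) 0 = (1 - \<kappa> $ 4) / 2 * poly (snd \<phi> $ 1) 0"
  unfolding forall_4 pline_normal_form_iff[OF assms(1-3)] \<delta>_def
  by (simp add: sing_def vec_at_def)

lemma hom_from_line_bundle_B_iff:
  assumes "is_B E"
  shows "hom_from_line_bundle (- 1) \<phi> E \<longleftrightarrow>
    (\<forall>x. x \<noteq> 0 \<longrightarrow> poly (fst \<phi> $ 1) x = x ^ 1 * poly (snd \<phi> $ 1) (1 / x) \<and>
      poly (fst \<phi> $ 2) x = x ^ 2 * poly (snd \<phi> $ 2) (1 / x))"
proof -
  have "x powi (- 1) *s evv (fst \<phi>) x = transition E x *v evv (snd \<phi>) (1 / x) \<longleftrightarrow>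
      poly (fst \<phi> $ 1) x = x ^ 1 * poly (snd \<phi> $ 1) (1 / x) \<and>
      poly (fst \<phi> $ 2) x = x ^ 2 * poly (snd \<phi> $ 2) (1 / x)" if "x \<noteq> 0" for x
    using assms that
    by (simp add: is_B_def vec2_eq_iff mult_vec2_nth power_int_minus field_simps power2_eq_square)
  then show ?thesis
    by (simp add: hom_from_line_bundle_def)
qed

text \<open>The line conditions leave one linear equation for the first component. It fixes this
  component up to a factor, and the factor is nonzero, so there is exactly one zero and it is
  finite.\<close>

lemma hom_normal_form_first_component:
  assumes "t \<noteq> 0" "t \<noteq> 1" "q \<notin> {0, 1, t}" "p \<noteq> 0"
    and "hom_from_line_bundle (- 1) \<phi> (normal_form t \<kappa> q p)" "fst \<phi> \<noteq> 0"
    and lines: "\<And>i. vec_at \<phi> (sing t i) \<in> pline (normal_form t \<kappa> q p) i"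
  shows "vec_at \<phi> z $ 1 = 0 \<longleftrightarrow> z = Fin (q + kappa0 \<kappa> / p)"
proof -
  let ?m = "fst \<phi> $ 1" and ?n = "fst \<phi> $ 2"
  have eq: "poly ?m x = x ^ 1 * poly (snd \<phi> $ 1) (1 / x)"
    "poly ?n x = x ^ 2 * poly (snd \<phi> $ 2) (1 / x)" if "x \<notin> {0}" for x
    using assms(5) that unfolding hom_from_line_bundle_B_iff[OF is_B_normal_form] by blast+
  have f: "finite {0 :: complex}"
    by simp
  note deg = poly_inversion_degree[OF f eq(1)] poly_inversion_degree[OF f eq(2)]
  note coe = poly_inversion_coeff[OF f eq(1)] poly_inversion_coeff[OF f eq(2)]
  define m0 m1 where "m0 = coeff ?m 0" "m1 = coeff ?m 1"
  define n0 n1 n2 where "n0 = coeff ?n 0" "n1 = coeff ?n 1" "n2 = coeff ?n 2"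
  have m: "?m = [:m0, m1:]"
    unfolding m0_m1_def by (rule poly_eq_coeffs_1[OF deg(1)])
  have n: "?n = [:n0, n1, n2:]"
    unfolding n0_n1_n2_def by (rule poly_eq_coeffs_2[OF deg(2)])
  have inf: "poly (snd \<phi> $ 1) 0 = m1" "poly (snd \<phi> $ 2) 0 = n2"
    using coe(1)[of 0] coe(2)[of 0] by (simp_all add: poly_0_coeff_0 m0_m1_def n0_n1_n2_def)
  define \<delta> where "\<delta> = delta t \<kappa> q p"
  have vals: "poly ?m 0 = m0" "poly ?m 1 = m0 + m1" "poly ?m t = m0 + m1 * t"
    "poly ?n 0 = n0" "poly ?n 1 = n0 + n1 + n2" "poly ?n t = n0 + n1 * t + n2 * t\<^sup>2"
    by (simp_all add: m n power2_eq_square algebra_simps)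
  have "\<forall>i. vec_at \<phi> (sing t i) \<in> pline (normal_form t \<kappa> q p) i"
    using lines by blast
  then have l: "n0 = (\<kappa> $ 1 * t / 2 + \<delta>) * m0 / (0 - q)"
    "n0 + n1 + n2 = (\<kappa> $ 2 * (1 - t) / 2 + \<delta>) * (m0 + m1) / (1 - q)"
    "n0 + n1 * t + n2 * t\<^sup>2 = (\<kappa> $ 3 * (t * (t - 1)) / 2 + \<delta>) * (m0 + m1 * t) / (t - q)"
    "n2 = (1 - \<kappa> $ 4) / 2 * m1"
    unfolding vec_at_pline_normal_form_iff[OF assms(1-3)] \<delta>_def[symmetric] vals inf by blast+
  have swap: "a = b - c \<Longrightarrow> c = b - a" for a b c :: complex
    by (simp add: algebra_simps)
  \<comment> \<open>Lagrange's formula for the leading coefficient of a quadratic in terms of its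
    values at 0, 1 and t.\<close>
  have "n2 = n0 / t + (n0 + n1 + n2) / (1 - t) + (n0 + n1 * t + n2 * t\<^sup>2) / (t * (t - 1))"
  proof -
    have "1 - t \<noteq> 0" "t - 1 \<noteq> 0"
      using assms(2) by auto
    then show ?thesis
      using assms(1) by (simp add: divide_simps) (simp add: algebra_simps power2_eq_square)
  qed
  also have "\<dots> = m1 * (\<kappa> $ 1 + \<kappa> $ 2 + \<kappa> $ 3) / 2 - (m0 + m1 * q) * p"
    unfolding l(2,3) lagrange_sum_delta[OF assms(1-3), symmetric] \<delta>_def[symmetric]
    unfolding l(1) by (simp only: divide_divide_eq_left)
  finally have "(m0 + m1 * q) * p = m1 * (\<kappa> $ 1 + \<kappa> $ 2 + \<kappa> $ 3) / 2 - (1 - \<kappa> $ 4) / 2 * m1"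
    unfolding l(4) by (rule swap)
  also have "\<dots> = - m1 * kappa0 \<kappa>"
    by (simp add: kappa0_def sum_4 field_simps)
  finally have "(m0 + m1 * q) * p = - m1 * kappa0 \<kappa>" .
  then have m0: "m0 = - m1 * (q + kappa0 \<kappa> / p)"
    using assms(4) by (simp add: field_simps add_eq_0_iff2)
  \<comment> \<open>Otherwise the first component is zero; then the line conditions make the second
    one zero as well.\<close>
  have "m1 \<noteq> 0"
  proof
    assume "m1 = 0"
    then have "m0 = 0"
      using m0 by simp
    then have "n0 = 0" "n2 = 0" "n1 = 0"
      using l(1,2,4) \<open>m1 = 0\<close> by simp_all
    then have "fst \<phi> = 0"
      using m n \<open>m1 = 0\<close> \<open>m0 = 0\<close> by (simp add: vec2_eq_iff)
    then show False
      using assms(6) by simp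
  qed
  then show ?thesis
  proof (cases z)
    case (Fin a)
    have "vec_at \<phi> z $ 1 = m1 * (a - (q + kappa0 \<kappa> / p))"
      by (simp add: vec_at_def Fin m m0 algebra_simps)
    then show ?thesis
      using \<open>m1 \<noteq> 0\<close> Fin by simp
  next
    case Infty
    then show ?thesis
      using \<open>m1 \<noteq> 0\<close> inf by (simp add: vec_at_def)
  qed
qed

text \<open>The first component is the monic linear polynomial with the required zero, and the
  second is interpolated at 0, 1, t. The condition at infinity then holds because of the choice of
  the zero.\<close>

lemma hom_normal_form_exists:
  assumes "t \<noteq> 0" "t \<noteq> 1" "q \<notin> {0, 1, t}" "p \<noteq> 0"
  obtains \<phi> where "hom_from_line_bundle (- 1) \<phi> (normal_form t \<kappa> q p)" "fst \<phi> \<noteq> 0"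
    "\<And>i. vec_at \<phi> (sing t i) \<in> pline (normal_form t \<kappa> q p) i"
proof -
  define \<delta> where "\<delta> = delta t \<kappa> q p"
  define m0 where "m0 = - (q + kappa0 \<kappa> / p)"
  \<comment> \<open>The prescribed values of the quadratic at 0, 1, t divided by the derivative of
    x(x-1)(x-t) there: the weights of (x-1)(x-t), x(x-t) and x(x-1).\<close>
  define g1 g2 g3 where "g1 = (\<kappa> $ 1 * t / 2 + \<delta>) * m0 / ((0 - q) * t)"
    "g2 = (\<kappa> $ 2 * (1 - t) / 2 + \<delta>) * (m0 + 1) / ((1 - q) * (1 - t))"
    "g3 = (\<kappa> $ 3 * (t * (t - 1)) / 2 + \<delta>) * (m0 + t) / ((t - q) * (t * (t - 1)))"
  note g = this
  have "g1 + g2 + g3 = (\<kappa> $ 1 + \<kappa> $ 2 + \<kappa> $ 3) / 2 - (m0 + q) * p"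
    using lagrange_sum_delta[OF assms(1-3), of \<kappa> p m0 1] by (simp add: g \<delta>_def)
  also have "(m0 + q) * p = - kappa0 \<kappa>"
    using assms(4) by (simp add: m0_def)
  finally have sum: "g1 + g2 + g3 = (1 - \<kappa> $ 4) / 2"
    by (simp add: kappa0_def sum_4 add_divide_distrib diff_divide_distrib)
  define n0 n1 n2 where "n0 = g1 * t" "n1 = - (g1 * (1 + t) + g2 * t + g3)" "n2 = g1 + g2 + g3"
  note n = this
  define \<phi> :: "(complex poly ^ 2) \<times> (complex poly ^ 2)" where
    "\<phi> = (vector [[:m0, 1:], [:n0, n1, n2:]], vector [[:1, m0:], [:n2, n1, n0:]])"
  have "hom_from_line_bundle (- 1) \<phi> (normal_form t \<kappa> q p)"
    unfolding hom_from_line_bundle_B_iff[OF is_B_normal_form]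
    by (simp add: \<phi>_def field_simps power2_eq_square)
  moreover have "fst \<phi> \<noteq> 0"
    by (simp add: \<phi>_def vec2_eq_iff)
  moreover have "vec_at \<phi> (sing t i) \<in> pline (normal_form t \<kappa> q p) i" for i
  proof -
    have canc: "x / (y * z) * z = x / y" if "z \<noteq> 0" for x y z :: complex
      using that by simp
    have nz: "1 - t \<noteq> 0" "t * (t - 1) \<noteq> 0"
      using assms by auto
    have at_0: "n0 = (\<kappa> $ 1 * t / 2 + \<delta>) * m0 / (0 - q)"
      unfolding n g canc[OF assms(1)] ..
    have "n0 + n1 + n2 = g2 * (1 - t)"
      by (simp add: n algebra_simps)
    then have at_1: "n0 + n1 + n2 = (\<kappa> $ 2 * (1 - t) / 2 + \<delta>) * (m0 + 1) / (1 - q)"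
      unfolding g canc[OF nz(1)] .
    have "n0 + n1 * t + n2 * t\<^sup>2 = g3 * (t * (t - 1))"
      by (simp add: n power2_eq_square algebra_simps)
    then have at_t: "n0 + n1 * t + n2 * t\<^sup>2 = (\<kappa> $ 3 * (t * (t - 1)) / 2 + \<delta>) * (m0 + t) / (t - q)"
      unfolding g canc[OF nz(2)] .
    have vals: "poly (fst \<phi> $ 1) 0 = m0" "poly (fst \<phi> $ 1) 1 = m0 + 1" "poly (fst \<phi> $ 1) t = m0 + t"
      "poly (fst \<phi> $ 2) 0 = n0" "poly (fst \<phi> $ 2) 1 = n0 + n1 + n2"
      "poly (fst \<phi> $ 2) t = n0 + n1 * t + n2 * t\<^sup>2"
      "poly (snd \<phi> $ 1) 0 = 1" "poly (snd \<phi> $ 2) 0 = n2"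
      by (simp_all add: \<phi>_def power2_eq_square algebra_simps)
    have "\<forall>i. vec_at \<phi> (sing t i) \<in> pline (normal_form t \<kappa> q p) i"
      unfolding vec_at_pline_normal_form_iff[OF assms(1-3)] \<delta>_def[symmetric] vals
      using at_0 at_1 at_t sum[folded n(3)] by (simp only: mult_1_right simp_thms)
    then show ?thesis ..
  qed
  ultimately show ?thesis
    using that by blast
qed

section \<open>Passing to other representatives of the quasiparabolic class\<close>

lemma hom_from_line_bundle_iso:
  assumes "hom_from_line_bundle n \<phi> E" "vbundle_iso \<psi> E F"
  shows "hom_from_line_bundle n (fst \<psi> *v fst \<phi>, snd \<psi> *v snd \<phi>) F"
  unfolding hom_from_line_bundle_def
proof (intro allI impI)
  fix x :: complex assume x: "x \<noteq> 0"
  have "x powi n *s evv (fst \<psi> *v fst \<phi>) x = evm (fst \<psi>) x *v (x powi n *s evv (fst \<phi>) x)"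
    by (simp add: evm_mult_vec vec.scale)
  also have "\<dots> = (evm (fst \<psi>) x ** transition E x) *v evv (snd \<phi>) (1 / x)"
    using assms(1) x by (simp add: hom_from_line_bundle_def matrix_vector_mul_assoc)
  also have "\<dots> = transition F x *v evv (snd \<psi> *v snd \<phi>) (1 / x)"
    using assms(2) x by (simp add: vbundle_iso_def evm_mult_vec matrix_vector_mul_assoc)
  finally show "x powi n *s evv (fst (fst \<psi> *v fst \<phi>, snd \<psi> *v snd \<phi>)) x =
      transition F x *v evv (snd (fst \<psi> *v fst \<phi>, snd \<psi> *v snd \<phi>)) (1 / x)"
    by simp
qed

lemma vec_at_mult: "vec_at (M *v v, M' *v v') z = mat_at (M, M') z *v vec_at (v, v') z"
  by (simp add: vec_at_def mat_at_def evm_mult_vec split: proj_line.split)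

lemma qpbundle_iso_truncate: "qpbundle_iso t \<psi> (qpbundle.truncate T) E \<longleftrightarrow> qpbundle_iso t \<psi> T E"
  by (simp add: qpbundle_iso_def vbundle_iso_def transition_def qpbundle.truncate_def)

text \<open>The normal form supplies a witness. For uniqueness, a map into any other representative
  on O + O(1) is carried over to the normal form; the isomorphism is lower triangular, so the zero
  of the first component stays in place.\<close>

lemma Q_param_normal_class:
  assumes "t \<noteq> 0" "t \<noteq> 1" "q \<notin> {0, 1, t}" "p \<noteq> 0"
  shows "Q_param t (normal_class t \<kappa> q p) = Fin (q + kappa0 \<kappa> / p)"
  unfolding Q_param_def parabolic_param_def
proof (rule the_equality)
  let ?T = "normal_form t \<kappa> q p"
  let ?E = "qpbundle.truncate ?T"
  have tr: "transition ?E = transition ?T" "pline ?E = pline ?T"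
    by (simp_all add: fun_eq_iff transition_def qpbundle.truncate_def)
  obtain \<phi> where \<phi>: "hom_from_line_bundle (- 1) \<phi> ?T" "fst \<phi> \<noteq> 0"
    "\<And>i. vec_at \<phi> (sing t i) \<in> pline ?T i"
    using hom_normal_form_exists[OF assms, of \<kappa>] by blast
  have "is_qpbundle 1 ?T"
    using is_point_normal_form[OF assms(1-3)] by (simp add: is_point_def)
  then have "is_qpbundle 1 ?E"
    unfolding is_qpbundle_def is_vbundle_def tr .
  then have "?E \<in> qpbundle_class t (normal_class t \<kappa> q p)"
    using qpbundle_iso_refl[of t ?E] normal_form_in_class[OF assms(1-3), of \<kappa> p]
    unfolding qpbundle_class_def mem_Collect_eq by blast
  moreover have "is_B ?E" "hom_from_line_bundle (- 1) \<phi> ?E"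
    using is_B_normal_form \<phi>(1) by (simp_all only: is_B_def hom_from_line_bundle_def tr)
  moreover have "vec_at \<phi> (Fin (q + kappa0 \<kappa> / p)) $ 1 = 0"
    using hom_normal_form_first_component[OF assms \<phi>] by simp
  ultimately show "\<exists>E\<in>qpbundle_class t (normal_class t \<kappa> q p). \<exists>\<phi>. is_B E \<and> fst \<phi> \<noteq> 0 \<and>
     hom_from_line_bundle (- 1) \<phi> E \<and> (\<forall>i. vec_at \<phi> (sing t i) \<in> pline E i) \<and>
     vec_at \<phi> (Fin (q + kappa0 \<kappa> / p)) $ 1 = 0"
    using \<phi>(2,3) tr by metis
next
  let ?T = "normal_form t \<kappa> q p"
  fix z assume "\<exists>E\<in>qpbundle_class t (normal_class t \<kappa> q p). \<exists>\<phi>. is_B E \<and> fst \<phi> \<noteq> 0 \<and>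
     hom_from_line_bundle (- 1) \<phi> E \<and> (\<forall>i. vec_at \<phi> (sing t i) \<in> pline E i) \<and>
     vec_at \<phi> z $ 1 = 0"
  then obtain E \<phi> where E: "E \<in> qpbundle_class t (normal_class t \<kappa> q p)" "is_B E"
    and \<phi>: "fst \<phi> \<noteq> 0" "hom_from_line_bundle (- 1) \<phi> E" "\<And>i. vec_at \<phi> (sing t i) \<in> pline E i"
      "vec_at \<phi> z $ 1 = 0"
    by blast
  obtain T \<psi> where T: "T \<in> normal_class t \<kappa> q p" "qpbundle_iso t \<psi> T E"
    using E(1) by (auto simp: qpbundle_class_def qpbundle_iso_truncate)
  obtain \<rho> where "pconnection_iso t \<rho> ?T T"
    using T(1) by (rule normal_class_iso)
  then have "qpbundle_iso t \<rho> ?T T"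
    by (simp add: pconnection_iso_def)
  from qpbundle_iso_sym[OF qpbundle_iso_trans[OF this T(2)]]
  obtain \<theta> where \<theta>: "qpbundle_iso t \<theta> E ?T"
    by blast
  then have iso: "vbundle_iso \<theta> E ?T"
    by (simp add: qpbundle_iso_def)
  obtain \<alpha> \<beta> u v where ab: "\<alpha> \<noteq> 0" "\<beta> \<noteq> 0"
    "fst \<theta> = mat2 [:\<alpha>:] 0 [:u, v:] [:\<beta>:]" "snd \<theta> = mat2 [:\<alpha>:] 0 [:v, u:] [:\<beta>:]"
    using vbundle_iso_B[OF E(2) is_B_normal_form iso] .
  define \<eta> where "\<eta> = (fst \<theta> *v fst \<phi>, snd \<theta> *v snd \<phi>)"
  have at: "vec_at \<eta> z = mat_at \<theta> z *v vec_at \<phi> z" for z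
    by (simp add: \<eta>_def vec_at_mult)
  have "hom_from_line_bundle (- 1) \<eta> ?T"
    unfolding \<eta>_def by (rule hom_from_line_bundle_iso[OF \<phi>(2) iso])
  moreover have "fst \<eta> \<noteq> 0"
  proof
    assume "fst \<eta> = 0"
    then have "[:\<alpha>:] * fst \<phi> $ 1 = 0" "[:u, v:] * fst \<phi> $ 1 + [:\<beta>:] * fst \<phi> $ 2 = 0"
      unfolding \<eta>_def ab by (simp_all add: vec2_eq_iff mult_vec2_nth)
    then have "fst \<phi> = 0"
      using ab(1,2) by (auto simp: vec2_eq_iff)
    then show False
      using \<phi>(1) by simp
  qed
  moreover have "vec_at \<eta> (sing t i) \<in> pline ?T i" for i
    using \<theta> \<phi>(3)[of i] unfolding at qpbundle_iso_def by blast
  \<comment> \<open>The first row of \<theta> is (\<alpha>, 0), so the first component is only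
    multiplied by \<alpha>.\<close>
  moreover have "vec_at \<eta> z $ 1 = 0"
    unfolding at using \<phi>(4) by (cases z) (simp_all add: mult_vec2_nth mat_at_def ab)
  ultimately show "z = Fin (q + kappa0 \<kappa> / p)"
    using hom_normal_form_first_component[OF assms] by blast
qed

section \<open>The Okamoto involution\<close>

text \<open>The shift adds 4 \<kappa>_0 to a sum equal to 1 - 2 \<kappa>_0. The change of sign is
  the reason why \<open>s0_coords\<close> undoes itself.\<close>

lemma kappa0_shift: "kappa0 (\<chi> i. \<kappa> $ i + kappa0 \<kappa>) = - kappa0 \<kappa>"
  by (simp add: kappa0_def sum_4 field_simps)

text \<open>With k = \<kappa>_0 the sum of the \<kappa>_i is 1 - 2k, so the conditions of
  \<open>generic\<close> are permuted: an integral \<kappa>_i + k would make a signed sum with one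
  minus odd, and a signed sum of the shifted parameters reduces to an old condition according to its
  number of minus signs.\<close>

lemma generic_shift:
  assumes "generic \<kappa>"
  shows "generic (\<chi> i. \<kappa> $ i + kappa0 \<kappa>)"
proof -
  define k where "k = kappa0 \<kappa>"
  have S: "\<kappa> $ 1 + \<kappa> $ 2 + \<kappa> $ 3 + \<kappa> $ 4 = 1 - 2 * k"
    by (simp add: k_def kappa0_def sum_4 field_simps)
  have odd: "\<epsilon> 1 * \<kappa> $ 1 + \<epsilon> 2 * \<kappa> $ 2 + \<epsilon> 3 * \<kappa> $ 3 + \<epsilon> 4 * \<kappa> $ 4 \<noteq> 2 * of_int n + 1"
    if "\<forall>i. \<epsilon> i \<in> {1, - 1}" for \<epsilon> :: "4 \<Rightarrow> complex" and n :: int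
    using assms that unfolding generic_def sum_4 by blast
  have int: "\<kappa> $ i \<noteq> of_int n" for i n
    using assms unfolding generic_def by (metis Ints_of_int)
  have "\<kappa> $ i + k \<noteq> of_int n" for i n
  proof
    assume eq: "\<kappa> $ i + k = of_int n"
    \<comment> \<open>One minus sign, at \<open>i\<close>: the signed sum is 1 - 2k - 2 \<kappa>_i =
      1 - 2n.\<close>
    define \<epsilon> :: "4 \<Rightarrow> complex" where "\<epsilon> = (\<lambda>j. if j = i then - 1 else 1)"
    have "\<epsilon> 1 * \<kappa> $ 1 + \<epsilon> 2 * \<kappa> $ 2 + \<epsilon> 3 * \<kappa> $ 3 + \<epsilon> 4 * \<kappa> $ 4 =
        \<kappa> $ 1 + \<kappa> $ 2 + \<kappa> $ 3 + \<kappa> $ 4 - 2 * \<kappa> $ i"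
      using exhaust_4[of i] by (auto simp: \<epsilon>_def)
    also have "\<dots> = 2 * of_int (- n) + 1"
      unfolding S of_int_minus eq[symmetric] by (simp add: algebra_simps)
    finally have "\<epsilon> 1 * \<kappa> $ 1 + \<epsilon> 2 * \<kappa> $ 2 + \<epsilon> 3 * \<kappa> $ 3 + \<epsilon> 4 * \<kappa> $ 4 = 2 * of_int (- n) + 1" .
    moreover have "\<forall>i. \<epsilon> i \<in> {1, - 1}"
      by (simp add: \<epsilon>_def)
    ultimately show False
      using odd by blast
  qed
  moreover have "(\<Sum>i\<in>UNIV. \<epsilon> i * (\<kappa> $ i + k)) \<noteq> 2 * of_int n + 1"
    if \<epsilon>: "\<forall>i. \<epsilon> i \<in> {1, - 1}" for \<epsilon> :: "4 \<Rightarrow> complex" and n :: int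
  proof
    assume "(\<Sum>i\<in>UNIV. \<epsilon> i * (\<kappa> $ i + k)) = 2 * of_int n + 1"
    then have E: "\<epsilon> 1 * (\<kappa> $ 1 + k) + \<epsilon> 2 * (\<kappa> $ 2 + k) + \<epsilon> 3 * (\<kappa> $ 3 + k) + \<epsilon> 4 * (\<kappa> $ 4 + k) =
        2 * of_int n + 1"
      by (simp add: sum_4)
    \<comment> \<open>Each sign pattern contradicts one of these facts: no minus \<open>o1\<close>,
      four minuses \<open>o2\<close>, one minus \<open>i1\<close> at that index, three minuses
      \<open>i2\<close> at the index of the plus. With two minuses k cancels and \<open>odd\<close>
      applies directly.\<close>
    have o1: "\<kappa> $ 1 + \<kappa> $ 2 + \<kappa> $ 3 + \<kappa> $ 4 \<noteq> 1 - 2 * of_int n"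
      using odd[of "\<lambda>_. 1" "- n"] by simp
    have o2: "\<kappa> $ 1 + \<kappa> $ 2 + \<kappa> $ 3 + \<kappa> $ 4 \<noteq> 2 * of_int n + 3"
      using odd[of "\<lambda>_. 1" "n + 1"] by (simp add: algebra_simps)
    have i1: "\<kappa> $ i \<noteq> - of_int n" and i2: "\<kappa> $ i \<noteq> of_int n + 1" for i
      using int[of i "- n"] int[of i "n + 1"] by simp_all
    note odd = odd[OF \<epsilon>, of n]
    have "\<epsilon> 1 = 1 \<or> \<epsilon> 1 = - 1" "\<epsilon> 2 = 1 \<or> \<epsilon> 2 = - 1" "\<epsilon> 3 = 1 \<or> \<epsilon> 3 = - 1" "\<epsilon> 4 = 1 \<or> \<epsilon> 4 = - 1"
      using \<epsilon> by blast+
    then show False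
      apply (elim disjE)
      apply (insert E S)
      apply ((rule notE[OF o1], algebra) | (rule notE[OF o2], algebra) |
          (rule notE[OF i1[of 1]], algebra) | (rule notE[OF i1[of 2]], algebra) |
          (rule notE[OF i1[of 3]], algebra) | (rule notE[OF i1[of 4]], algebra) |
          (rule notE[OF i2[of 1]], algebra) | (rule notE[OF i2[of 2]], algebra) |
          (rule notE[OF i2[of 3]], algebra) | (rule notE[OF i2[of 4]], algebra) |
          (rule notE[OF odd], algebra))+
      done
  qed
  ultimately show ?thesis
    unfolding generic_def k_def by (auto elim!: Ints_cases)
qed

text \<open>Both exchange identities come from the formula for Q. The image under the involution is
  the class with coordinates given by \<open>s0_coords\<close>; its apparent singularity is Q, and
  since \<kappa>_0 has changed sign there, the same formula returns q.\<close>

theorem mainTheorem6: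
  fixes t p q :: complex and \<kappa> :: "complex ^ 4" and m :: "pconnection set"
  assumes "t \<noteq> 0" and "t \<noteq> 1"
    and "(\<kappa>, m) \<in> family_chart t"
    and "family_coords t (\<kappa>, m) = (\<kappa>, q, p)"
    and "p \<noteq> 0"
  shows "Q_param t m = Fin (q + kappa0 \<kappa> / p) \<and>
    (q + kappa0 \<kappa> / p \<notin> {0, 1, t} \<longrightarrow>
       okamoto_s0 t (\<kappa>, m) \<in> family_chart t \<and>
       family_coords t (okamoto_s0 t (\<kappa>, m)) = s0_coords (\<kappa>, q, p) \<and>
       Q_param t m = apparent_sing (snd (okamoto_s0 t (\<kappa>, m))) \<and>
       apparent_sing m = Q_param t (snd (okamoto_s0 t (\<kappa>, m))))"
proof -
  note t = assms(1,2)
  obtain q' p' where "generic \<kappa>" and q': "q' \<notin> {0, 1, t}" and m': "m = normal_class t \<kappa> q' p'"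
    using assms(3) unfolding family_chart_iff[OF t] by blast
  then have "q' = q" "p' = p"
    using assms(4) family_coords_normal_class[OF t q'] by auto
  then have q: "q \<notin> {0, 1, t}" and m: "m = normal_class t \<kappa> q p"
    using q' m' by simp_all
  define Q \<kappa>' where "Q = q + kappa0 \<kappa> / p" and "\<kappa>' = (\<chi> i. \<kappa> $ i + kappa0 \<kappa>)"
  have Qm: "Q_param t m = Fin Q"
    unfolding m Q_def by (rule Q_param_normal_class[OF t q assms(5)])
  moreover have "okamoto_s0 t (\<kappa>, m) \<in> family_chart t \<and>
       family_coords t (okamoto_s0 t (\<kappa>, m)) = s0_coords (\<kappa>, q, p) \<and>
       Q_param t m = apparent_sing (snd (okamoto_s0 t (\<kappa>, m))) \<and>
       apparent_sing m = Q_param t (snd (okamoto_s0 t (\<kappa>, m)))" if Q: "Q \<notin> {0, 1, t}"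
  proof -
    let ?Y = "(\<kappa>', normal_class t \<kappa>' Q p)"
    have s0: "s0_coords (\<kappa>, q, p) = (\<kappa>', Q, p)"
      by (simp add: Q_def \<kappa>'_def)
    have Y: "?Y \<in> family_chart t" "family_coords t ?Y = s0_coords (\<kappa>, q, p)"
      using generic_shift[OF \<open>generic \<kappa>\<close>] Q family_coords_normal_class[OF t Q]
      unfolding s0 family_chart_iff[OF t] by (auto simp: \<kappa>'_def)
    \<comment> \<open>The description determines a unique element, since a member of the chart is
      the class of the normal form with its own coordinates.\<close>
    have "okamoto_s0 t (\<kappa>, m) = ?Y"
      unfolding okamoto_s0_def assms(4)
    proof (rule the_equality)
      fix Z assume Z: "Z \<in> family_chart t \<and> family_coords t Z = s0_coords (\<kappa>, q, p)"
      obtain l n where "Z = (l, n)"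
        by (cases Z)
      then obtain a b where ab: "a \<notin> {0, 1, t}" "Z = (l, normal_class t l a b)"
        using Z family_chart_iff[OF t] by blast
      then have "(l, a, b) = (\<kappa>', Q, p)"
        using Z family_coords_normal_class[OF t ab(1), of l b] s0 by metis
      then show "Z = ?Y"
        using ab(2) by simp
    qed (use Y in blast)
    moreover have "Q_param t (normal_class t \<kappa>' Q p) = Fin q"
      using Q_param_normal_class[OF t Q assms(5), of \<kappa>'] kappa0_shift[of \<kappa>]
      by (simp add: Q_def \<kappa>'_def)
    ultimately show ?thesis
      using Y Qm apparent_sing_normal_class[OF t Q] apparent_sing_normal_class[OF t q]
      by (simp only: snd_conv m)
  qed
  ultimately show ?thesis
    unfolding Q_def by blast
qed

end
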